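(* There exists a uniformly c.e. independent sequence $\{\nu_i\}_{i\in\mathbb{N}}$ of Friedberg numberings of $\mathcal{P}^{(1)}$, the set of all partial computable functions from $\mathbb{N}$ to $\mathbb{N}$.
   Context: $\mathcal{P}^{(1)}$ denotes the set of all partial computable functions from $\mathbb{N}$ to $\mathbb{N}$, and $\langle\cdot,\cdot\rangle$ is a fixed computable bijection from $\mathbb{N}^2$ to $\mathbb{N}$. A numbering of a set $\mathcal{A}$ is a surjective map $\nu\colon\mathbb{N}\to\mathcal{A}$. A numbering $\nu$ is reducible to a numbering $\mu$, written $\nu\leq\mu$, if there is a total computable function $f\colon\mathbb{N}\to\mathbb{N}$ with $\nu=\mu\circ f$. A numbering $\nu$ of a subset of $\mathcal{P}^{(1)}$ is computable if the partial function $(i,x)\mapsto\nu(i)(x)$ from $\mathbb{N}^2$ to $\mathbb{N}$ is partial computable. A Friedberg numbering is an injective computable numbering. A sequence $\{\nu_i\}_{i\in\mathbb{N}}$ of numberings of a subset of $\mathcal{P}^{(1)}$ is uniformly c.e. if the partial function $(i,n,x)\mapsto\nu_i(n)(x)$ from $\mathbb{N}^3$ to $\mathbb{N}$ is partial computable. The direct sum of a sequence $\{\mu_j\}_{j\in\mathbb{N}}$ of numberings of a set $\mathcal{A}$ is the numbering $\bigoplus_{j\in\mathbb{N}}\mu_j$ of $\mathcal{A}$ given by $\bigl(\bigoplus_{j\in\mathbb{N}}\mu_j\bigr)(\langle j,k\rangle)=\mu_j(k)$; the notation $\bigoplus_{j\neq i}\nu_j$ means the direct sum of the sequence $\nu_0,\ldots,\nu_{i-1},\nu_{i+1},\nu_{i+2},\ldots$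 obtained by omitting $\nu_i$ and reindexing by $\mathbb{N}$ in increasing order. A sequence $\{\nu_i\}_{i\in\mathbb{N}}$ of numberings of a set $\mathcal{A}$ is independent if $\nu_i\nleq\bigoplus_{j\neq i}\nu_j$ for all $i\in\mathbb{N}$. *)

theory Defs
  imports Complex_Main
begin

section \<open>Partial computable functions\<close>

text \<open>
  Programs for Kleene's partial recursive functions. Programs carry no arity: the arity of the
  function computed is the length of the argument list, and an application with an unsuitable
  number of arguments is undefined. Hence, for every fixed \<open>n\<close>, the \<open>n\<close>-ary functions computed by
  programs are exactly the \<open>n\<close>-ary partial recursive functions (the nowhere defined one included).
\<close>

datatype recf =
    Zero
  | Succ
  | Proj nat
  | Comp recf "recf list"
  | PrimRec recf recf
  | Mu recf

text \<open>
  \<open>None\<close> means divergence. Composition is strict in all inner functions. The recursion variable of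
  \<open>PrimRec\<close> and the search variable of \<open>Mu\<close> are the first argument; \<open>Mu p\<close> yields the least zero
  of \<open>p\<close> provided that \<open>p\<close> converges at all smaller values.
\<close>

fun eval :: "recf \<Rightarrow> nat list \<Rightarrow> nat option" where
  "eval Zero xs = Some 0"
| "eval Succ xs = (case xs of [x] \<Rightarrow> Some (Suc x) | _ \<Rightarrow> None)"
| "eval (Proj i) xs = (if i < length xs then Some (xs ! i) else None)"
| "eval (Comp p qs) xs =
     (if \<forall>q \<in> set qs. eval q xs \<noteq> None
      then eval p (map (\<lambda>q. the (eval q xs)) qs) else None)"
| "eval (PrimRec p q) xs =
     (case xs of
        [] \<Rightarrow> None
      | n # ys \<Rightarrow>
          rec_nat (eval p ys)
            (\<lambda>m r. case r of None \<Rightarrow> None | Some v \<Rightarrow> eval q (m # v # ys)) n)"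
| "eval (Mu p) xs =
     (if \<exists>n. eval p (n # xs) = Some 0 \<and> (\<forall>m<n. eval p (m # xs) \<noteq> None)
      then Some (LEAST n. eval p (n # xs) = Some 0) else None)"

definition partial_computable1 :: "(nat \<Rightarrow> nat option) \<Rightarrow> bool" where
  "partial_computable1 f \<longleftrightarrow> (\<exists>p. \<forall>x. eval p [x] = f x)"

definition partial_computable2 :: "(nat \<Rightarrow> nat \<Rightarrow> nat option) \<Rightarrow> bool" where
  "partial_computable2 f \<longleftrightarrow> (\<exists>p. \<forall>x y. eval p [x, y] = f x y)"

definition partial_computable3 :: "(nat \<Rightarrow> nat \<Rightarrow> nat \<Rightarrow> nat option) \<Rightarrow> bool" where
  "partial_computable3 f \<longleftrightarrow> (\<exists>p. \<forall>x y z. eval p [x, y, z] = f x y z)"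

definition total_computable :: "(nat \<Rightarrow> nat) \<Rightarrow> bool" where
  "total_computable f \<longleftrightarrow> partial_computable1 (\<lambda>x. Some (f x))"

definition P1 :: "(nat \<Rightarrow> nat option) set" where
  "P1 = {f. partial_computable1 f}"

definition computable_pairing :: "(nat \<times> nat \<Rightarrow> nat) \<Rightarrow> bool" where
  "computable_pairing pair \<longleftrightarrow>
     bij pair \<and> partial_computable2 (\<lambda>x y. Some (pair (x, y)))"

section \<open>Numberings\<close>

definition numbering :: "'a set \<Rightarrow> (nat \<Rightarrow> 'a) \<Rightarrow> bool" where
  "numbering A \<nu> \<longleftrightarrow> range \<nu> = A"

definition reducible :: "(nat \<Rightarrow> 'a) \<Rightarrow> (nat \<Rightarrow> 'a) \<Rightarrow> bool" where
  "reducible \<nu> \<mu> \<longleftrightarrow> (\<exists>f. total_computable f \<and> \<nu> = \<mu> \<circ> f)"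

definition computable_numbering ::
    "(nat \<Rightarrow> nat option) set \<Rightarrow> (nat \<Rightarrow> nat \<Rightarrow> nat option) \<Rightarrow> bool" where
  "computable_numbering A \<nu> \<longleftrightarrow> numbering A \<nu> \<and> partial_computable2 (\<lambda>i x. \<nu> i x)"

definition friedberg_numbering ::
    "(nat \<Rightarrow> nat option) set \<Rightarrow> (nat \<Rightarrow> nat \<Rightarrow> nat option) \<Rightarrow> bool" where
  "friedberg_numbering A \<nu> \<longleftrightarrow> computable_numbering A \<nu> \<and> inj \<nu>"

definition uniformly_ce :: "(nat \<Rightarrow> nat \<Rightarrow> nat \<Rightarrow> nat option) \<Rightarrow> bool" where
  "uniformly_ce \<nu> \<longleftrightarrow> partial_computable3 (\<lambda>i n x. \<nu> i n x)"

definition direct_sum :: "(nat \<times> nat \<Rightarrow> nat) \<Rightarrow> (nat \<Rightarrow> nat \<Rightarrow> 'a) \<Rightarrow> nat \<Rightarrow> 'a" where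
  "direct_sum pair \<mu> n = (case inv pair n of (j, k) \<Rightarrow> \<mu> j k)"

lemma direct_sum_pair:
  assumes "bij pair"
  shows "direct_sum pair \<mu> (pair (j, k)) = \<mu> j k"
  using assms by (simp add: direct_sum_def bij_is_inj)

definition omit :: "nat \<Rightarrow> (nat \<Rightarrow> 'a) \<Rightarrow> nat \<Rightarrow> 'a" where
  "omit i s j = (if j < i then s j else s (Suc j))"

definition independent_numberings ::
    "(nat \<times> nat \<Rightarrow> nat) \<Rightarrow> (nat \<Rightarrow> nat \<Rightarrow> 'a) \<Rightarrow> bool" where
  "independent_numberings pair \<nu> \<longleftrightarrow>
     (\<forall>i. \<not> reducible (\<nu> i) (direct_sum pair (omit i \<nu>)))"

end

theory Submission
  imports Defs "HOL-Library.Nat_Bijection" "HOL-Library.Infinite_Set"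
begin


text \<open>
  The numberings \<open>\<nu>\<^sub>i\<close> come from one construction of injective numberings, in which certain indices
  may be made to change their function once.

  \<^bold>\<open>Independence.\<close> Let \<open>j\<close> be an index in the sequence, \<open>e\<close> a program, and \<open>a\<close> the code of the pair
  \<open>(j, e)\<close>. In every \<open>\<nu>\<^sub>i\<close> the index \<open>2a\<close> begins as a name of the \<^emph>\<open>marker\<close> of \<open>a\<close>, a function whose
  domain is \<open>{0}\<close>, and in \<open>\<nu>\<^sub>j\<close> it remains one. In \<open>\<nu>\<^sub>i\<close> with \<open>i \<noteq> j\<close> it remains one unless program \<open>e\<close>
  halts on input \<open>2a\<close> and outputs the code of index \<open>2a\<close> of \<open>\<nu>\<^sub>i\<close>; if this event occurs, \<open>\<nu>\<^sub>i(2a)\<close> is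
  extended to a fresh finite function and the marker receives a new index in \<open>\<nu>\<^sub>i\<close>. If \<open>e\<close> computed a
  reduction of \<open>\<nu>\<^sub>j\<close> to the direct sum of the others, its output on \<open>2a\<close> would be the code of an index
  \<open>k\<close> of the marker in some \<open>\<nu>\<^sub>i\<close>. If \<open>k = 2a\<close>, the event occurs and \<open>\<nu>\<^sub>i(2a)\<close> is not the marker. If
  \<open>k \<noteq> 2a\<close>, the event does not occur, so \<open>2a\<close> and \<open>k\<close> are two indices of the marker in the injective
  numbering \<open>\<nu>\<^sub>i\<close>. Different pairs \<open>(j, e)\<close> use different markers, so they never disturb each other and no
  priority argument is needed.

  \<^bold>\<open>Injective numberings.\<close> Following Kummer's proof of Friedberg's theorem, the partial computable
  functions are split into the \<^emph>\<open>odd lists\<close>, which are the functions with domain \<open>{0..<k}\<close> for some odd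
  \<open>k\<close>, and all others. The others have a computable numbering \<open>published\<close> (lemmas
  \<open>limit_published\<close> and \<open>limit_published_not_odd\<close>). An item follows the function with index \<open>e\<close> as long as
  \<open>e\<close> looks like the least index of that function; when it no longer does, the item is released, that
  is, extended to an odd list. This can always be done, as every finite function has infinitely many
  extensions among the odd lists. The last entry of the odd list records which item was released and
  when, so that it is decidable whether a given odd list is used in this way; every odd list that
  is not gets an item of its own. Markers are odd lists of length one, and an index that leaves its
  marker is released in the same manner. Lemmas \<open>item_fun_inject\<close> and \<open>item_fun_surj\<close> state that
  every partial computable function belongs to exactly one item.

  \<^bold>\<open>Computability.\<close> Since items are numbers, the numberings are computable once a few predicates on
  numbers are decidable. The only substantial ingredient is a universal machine: it is decidable
  whether a number codes a derivation tree for the judgment that a program yields a given value on a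
  given input.
\<close>

section \<open>Closure properties of the computable functions\<close>

text \<open>
  The prefixes \<open>tc\<close>, \<open>tc2\<close> and \<open>dec\<close> mark closure rules for total computable functions of one and of
  two arguments and for decidable predicates. Once pairing is available, unary functions suffice:
  further arguments are packed into one number and read off by projections, so that a single set of
  introduction rules proves the computability of explicitly defined functions.
\<close>

definition total_computable2 :: "(nat \<Rightarrow> nat \<Rightarrow> nat) \<Rightarrow> bool" where
  "total_computable2 F \<longleftrightarrow> partial_computable2 (\<lambda>x y. Some (F x y))"

lemma total_computableI: "(\<And>x. eval p [x] = Some (f x)) \<Longrightarrow> total_computable f"
  by (auto simp: total_computable_def partial_computable1_def)

lemma total_computableE:
  assumes "total_computable f"
  obtains p where "\<And>x. eval p [x] = Some (f x)"
  using assms by (auto simp: total_computable_def partial_computable1_def)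

lemma total_computable2I: "(\<And>x y. eval p [x, y] = Some (F x y)) \<Longrightarrow> total_computable2 F"
  by (auto simp: total_computable2_def partial_computable2_def)

lemma total_computable2E:
  assumes "total_computable2 F"
  obtains p where "\<And>x y. eval p [x, y] = Some (F x y)"
  using assms by (auto simp: total_computable2_def partial_computable2_def)

lemma tc_comp:
  assumes "total_computable f" "total_computable g"
  shows "total_computable (\<lambda>x. f (g x))"
proof -
  obtain p where p: "\<And>x. eval p [x] = Some (f x)" using total_computableE[OF assms(1)] by blast
  obtain q where q: "\<And>x. eval q [x] = Some (g x)" using total_computableE[OF assms(2)] by blast
  show ?thesis by (rule total_computableI[of "Comp p [q]"]) (simp add: p q)
qed

lemma tc_comp2:
  assumes "total_computable2 F" "total_computable f" "total_computable g"
  shows "total_computable (\<lambda>x. F (f x) (g x))"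
proof -
  obtain p where p: "\<And>x y. eval p [x, y] = Some (F x y)" using total_computable2E[OF assms(1)] by blast
  obtain q where q: "\<And>x. eval q [x] = Some (f x)" using total_computableE[OF assms(2)] by blast
  obtain r where r: "\<And>x. eval r [x] = Some (g x)" using total_computableE[OF assms(3)] by blast
  show ?thesis by (rule total_computableI[of "Comp p [q, r]"]) (simp add: p q r)
qed

lemma tc2_comp:
  assumes "total_computable f" "total_computable2 G"
  shows "total_computable2 (\<lambda>x y. f (G x y))"
proof -
  obtain p where p: "\<And>x. eval p [x] = Some (f x)" using total_computableE[OF assms(1)] by blast
  obtain q where q: "\<And>x y. eval q [x, y] = Some (G x y)" using total_computable2E[OF assms(2)] by blast
  show ?thesis by (rule total_computable2I[of "Comp p [q]"]) (simp add: p q)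
qed

lemma tc2_comp2:
  assumes "total_computable2 F" "total_computable2 G" "total_computable2 H"
  shows "total_computable2 (\<lambda>x y. F (G x y) (H x y))"
proof -
  obtain p where p: "\<And>x y. eval p [x, y] = Some (F x y)" using total_computable2E[OF assms(1)] by blast
  obtain q where q: "\<And>x y. eval q [x, y] = Some (G x y)" using total_computable2E[OF assms(2)] by blast
  obtain r where r: "\<And>x y. eval r [x, y] = Some (H x y)" using total_computable2E[OF assms(3)] by blast
  show ?thesis by (rule total_computable2I[of "Comp p [q, r]"]) (simp add: p q r)
qed

lemma tc_id: "total_computable (\<lambda>x. x)"
  by (rule total_computableI[of "Proj 0"]) simp

lemma tc2_fst: "total_computable2 (\<lambda>x y. x)"
  by (rule total_computable2I[of "Proj 0"]) simp

lemma tc2_snd: "total_computable2 (\<lambda>x y. y)"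
  by (rule total_computable2I[of "Proj 1"]) simp

lemma constant_program: "\<exists>p. \<forall>xs. eval p xs = Some c"
proof (induction c)
  case 0
  have "\<forall>xs. eval Zero xs = Some 0" by simp
  then show ?case by blast
next
  case (Suc c)
  then obtain p where "\<forall>xs. eval p xs = Some c" by blast
  then have "\<forall>xs. eval (Comp Succ [p]) xs = Some (Suc c)" by simp
  then show ?case by blast
qed

lemma tc_const: "total_computable (\<lambda>x. c)"
  using constant_program[of c] by (auto intro: total_computableI)

lemma tc2_const: "total_computable2 (\<lambda>x y. c)"
  using constant_program[of c] by (auto intro: total_computable2I)

lemma tc_Suc': "total_computable Suc"
  by (rule total_computableI[of "Succ"]) simp

lemmas tc_Suc = tc_comp[OF tc_Suc']

lemma eval_PrimRec_total:
  assumes "eval p ys = Some a" "\<And>m v. eval q (m # v # ys) = Some (h m v)"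
  shows "eval (PrimRec p q) (n # ys) = Some (rec_nat a h n)"
  by (induction n) (use assms in auto)

lemma tc_rec_binary:
  assumes "total_computable2 h"
  shows "total_computable (\<lambda>n. rec_nat c h n)"
proof -
  obtain p where p: "\<And>xs. eval p xs = Some c" using constant_program by blast
  obtain q where q: "\<And>x y. eval q [x, y] = Some (h x y)" using total_computable2E[OF assms] by blast
  show ?thesis
    by (rule total_computableI[of "PrimRec p q"]) (rule eval_PrimRec_total; simp add: p q)
qed

lemma tc2_add: "total_computable2 (+)"
proof (rule total_computable2I)
  fix x y
  have "eval (PrimRec (Proj 0) (Comp Succ [Proj 1])) [x, y] = Some (rec_nat y (\<lambda>m v. Suc v) x)"
    by (rule eval_PrimRec_total) simp_all
  also have "rec_nat y (\<lambda>m v. Suc v) x = x + y" by (induction x) auto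
  finally show "eval (PrimRec (Proj 0) (Comp Succ [Proj 1])) [x, y] = Some (x + y)" .
qed

lemma tc_pred': "total_computable (\<lambda>n. n - 1)"
proof -
  have "rec_nat 0 (\<lambda>m r. m) n = n - 1" for n :: nat by (cases n) auto
  with tc_rec_binary[OF tc2_fst, of 0] show ?thesis by simp
qed

lemma tc2_diff: "total_computable2 (-)"
proof -
  obtain p where p: "\<And>x. eval p [x] = Some (x - 1)" using total_computableE[OF tc_pred'] by blast
  have rec: "rec_nat x (\<lambda>m v. v - 1) y = x - y" for x y :: nat by (induction y) auto
  have "eval (PrimRec (Proj 0) (Comp p [Proj 1])) [y, x] = Some (rec_nat x (\<lambda>m v. v - 1) y)" for x y
    by (rule eval_PrimRec_total) (simp_all add: p)
  then have "total_computable2 (\<lambda>y x. x - y)"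
    by (intro total_computable2I) (simp only: rec)
  from tc2_comp2[OF this tc2_snd tc2_fst] show ?thesis .
qed

lemmas tc_add = tc_comp2[OF tc2_add]
lemmas tc_diff = tc_comp2[OF tc2_diff]

subsection \<open>Pairing\<close>

definition pcode :: "nat \<Rightarrow> nat \<Rightarrow> nat" where "pcode a b = prod_encode (a, b)"
definition pfst :: "nat \<Rightarrow> nat" where "pfst z = fst (prod_decode z)"
definition psnd :: "nat \<Rightarrow> nat" where "psnd z = snd (prod_decode z)"

lemma pfst_pcode [simp]: "pfst (pcode a b) = a"
  and psnd_pcode [simp]: "psnd (pcode a b) = b"
  and pcode_proj [simp]: "pcode (pfst z) (psnd z) = z"
  and pcode_eq_iff [simp]: "pcode a b = pcode c d \<longleftrightarrow> a = c \<and> b = d"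
  by (simp_all add: pcode_def pfst_def psnd_def)

lemma pcode_0_0: "pcode 0 0 = 0"
  by (simp add: pcode_def prod_encode_def)

lemma pfst_0 [simp]: "pfst 0 = 0" and psnd_0 [simp]: "psnd 0 = 0"
  using pfst_pcode[of 0 0] psnd_pcode[of 0 0] by (simp_all add: pcode_0_0)

lemma le_pcode: "a \<le> pcode a b" "b \<le> pcode a b"
  by (simp_all add: pcode_def le_prod_encode_1 le_prod_encode_2)

text \<open>
  The number of the diagonal on which the pair coded by \<open>z\<close> lies, computed by primitive recursion on
  \<open>z\<close>. It yields both projections (lemmas \<open>pfst_eq\<close> and \<open>psnd_eq\<close>) before any search is available.
\<close>

definition diagonal :: "nat \<Rightarrow> nat" where
  "diagonal z = rec_nat 0 (\<lambda>m r. r + (1 - (triangle (Suc r) - Suc m))) z"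

lemma diagonal_bounds: "triangle (diagonal z) \<le> z \<and> z < triangle (Suc (diagonal z))"
proof (induction z)
  case 0
  show ?case by (simp add: diagonal_def)
next
  case (Suc z)
  have step: "diagonal (Suc z) = diagonal z + (1 - (triangle (Suc (diagonal z)) - Suc z))"
    by (simp add: diagonal_def)
  show ?case
  proof (cases "Suc z = triangle (Suc (diagonal z))")
    case True
    then have "diagonal (Suc z) = Suc (diagonal z)" using step by simp
    with True show ?thesis by simp
  next
    case False
    with Suc have "Suc z < triangle (Suc (diagonal z))" by simp
    then have "diagonal (Suc z) = diagonal z" using step by simp
    with Suc \<open>Suc z < triangle (Suc (diagonal z))\<close> show ?thesis by simp
  qed
qed

lemma triangle_mono: "a \<le> b \<Longrightarrow> triangle a \<le> triangle b"
  by (rule lift_Suc_mono_le[of triangle]) auto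

lemma diagonal_pcode: "diagonal (pcode a b) = a + b"
proof -
  let ?d = "diagonal (pcode a b)"
  have z: "pcode a b = triangle (a + b) + a" by (simp add: pcode_def prod_encode_def)
  have "triangle ?d < triangle (Suc (a + b))" "triangle (a + b) < triangle (Suc ?d)"
    using diagonal_bounds[of "pcode a b"] unfolding z by auto
  then have "\<not> Suc (a + b) \<le> ?d" "\<not> Suc ?d \<le> a + b"
    using triangle_mono by (meson leD)+
  then show ?thesis by simp
qed

lemma pfst_eq: "pfst z = z - triangle (diagonal z)"
  and psnd_eq: "psnd z = diagonal z - pfst z"
proof -
  have "diagonal z = pfst z + psnd z" using diagonal_pcode[of "pfst z" "psnd z"] by simp
  moreover have "triangle (pfst z + psnd z) + pfst z = z"
    using pcode_proj[of z] by (simp only: pcode_def prod_encode_def case_prod_conv)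
  ultimately have "diagonal z = pfst z + psnd z" "z = triangle (diagonal z) + pfst z"
    by simp_all
  then show "pfst z = z - triangle (diagonal z)" "psnd z = diagonal z - pfst z"
    by linarith+
qed

lemma tc_triangle': "total_computable triangle"
proof -
  have "total_computable2 (\<lambda>m r. r + Suc m)"
    by (intro tc2_comp2[OF tc2_add] tc2_comp[OF tc_Suc'] tc2_fst tc2_snd)
  from tc_rec_binary[OF this, of 0] have "total_computable (\<lambda>n. rec_nat 0 (\<lambda>m r. r + Suc m) n)" .
  moreover have "rec_nat 0 (\<lambda>m r. r + Suc m) n = triangle n" for n by (induction n) auto
  ultimately show ?thesis by simp
qed

lemma tc2_pcode: "total_computable2 pcode"
proof -
  have "total_computable2 (\<lambda>a b. triangle (a + b) + a)"
    by (intro tc2_comp2[OF tc2_add] tc2_comp[OF tc_triangle'] tc2_fst tc2_snd)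
  moreover have "pcode = (\<lambda>a b. triangle (a + b) + a)"
    by (simp add: fun_eq_iff pcode_def prod_encode_def)
  ultimately show ?thesis by simp
qed

lemma tc_diagonal': "total_computable diagonal"
proof -
  have "total_computable2 (\<lambda>m r. r + (1 - (triangle (Suc r) - Suc m)))"
    by (intro tc2_comp2[OF tc2_add] tc2_comp2[OF tc2_diff] tc2_comp[OF tc_triangle']
        tc2_comp[OF tc_Suc'] tc2_fst tc2_snd tc2_const)
  from tc_rec_binary[OF this, of 0] show ?thesis by (simp add: diagonal_def[abs_def])
qed

lemma tc_pfst': "total_computable pfst"
proof -
  have "total_computable (\<lambda>z. z - triangle (diagonal z))"
    by (intro tc_diff tc_comp[OF tc_triangle'] tc_diagonal' tc_id)
  then show ?thesis by (simp add: pfst_eq[abs_def])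
qed

lemma tc_psnd': "total_computable psnd"
proof -
  have "total_computable (\<lambda>z. diagonal z - pfst z)"
    by (intro tc_diff tc_pfst' tc_diagonal')
  then show ?thesis by (simp add: psnd_eq[abs_def])
qed

lemmas tc_pcode = tc_comp2[OF tc2_pcode]
lemmas tc_pfst = tc_comp[OF tc_pfst']
lemmas tc_psnd = tc_comp[OF tc_psnd']

subsection \<open>Recursion, decidable predicates and search\<close>

text \<open>
  The step function may depend on the argument \<open>x\<close> as well. Its premise is phrased through projections
  of the packed triple, so that it can be refined by the same introduction rules as the conclusion.
\<close>

lemma tc_rec:
  assumes a: "total_computable a" and n: "total_computable n"
    and h: "total_computable (\<lambda>z. h (pfst z) (pfst (psnd z)) (psnd (psnd z)))"
  shows "total_computable (\<lambda>x. rec_nat (a x) (\<lambda>m r. h x m r) (n x))"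
proof -
  obtain pa where pa: "\<And>x. eval pa [x] = Some (a x)" using total_computableE[OF a] by blast
  obtain pn where pn: "\<And>x. eval pn [x] = Some (n x)" using total_computableE[OF n] by blast
  obtain ph where ph: "\<And>z. eval ph [z] = Some (h (pfst z) (pfst (psnd z)) (psnd (psnd z)))"
    using total_computableE[OF h] by blast
  obtain pp where pp: "\<And>x y. eval pp [x, y] = Some (pcode x y)"
    using total_computable2E[OF tc2_pcode] by blast
  let ?q = "Comp ph [Comp pp [Proj 2, Comp pp [Proj 0, Proj 1]]]"
  have "eval (PrimRec pa ?q) (k # [x]) = Some (rec_nat (a x) (h x) k)" for k x
    by (rule eval_PrimRec_total) (simp_all add: pa ph pp)
  then show ?thesis
    by (intro total_computableI[of "Comp (PrimRec pa ?q) [pn, Proj 0]"]) (simp add: pn del: eval.simps(5))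
qed

definition decidable :: "(nat \<Rightarrow> bool) \<Rightarrow> bool" where
  "decidable P \<longleftrightarrow> total_computable (\<lambda>x. of_bool (P x))"

lemma decidable_comp: "decidable P \<Longrightarrow> total_computable f \<Longrightarrow> decidable (\<lambda>x. P (f x))"
  unfolding decidable_def by (rule tc_comp)

lemma dec_not: "decidable P \<Longrightarrow> decidable (\<lambda>x. \<not> P x)"
proof -
  assume "decidable P"
  then have "total_computable (\<lambda>x. 1 - of_bool (P x))"
    unfolding decidable_def by (intro tc_diff tc_const)
  moreover have "1 - of_bool (P x) = (of_bool (\<not> P x) :: nat)" for x by simp
  ultimately show ?thesis unfolding decidable_def by (simp only:)
qed

lemma dec_conj: "decidable P \<Longrightarrow> decidable Q \<Longrightarrow> decidable (\<lambda>x. P x \<and> Q x)"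
proof -
  assume "decidable P" "decidable Q"
  then have "total_computable (\<lambda>x. (of_bool (P x) + of_bool (Q x)) - 1)"
    unfolding decidable_def by (intro tc_diff tc_add tc_const)
  moreover have "(of_bool (P x) + of_bool (Q x)) - 1 = (of_bool (P x \<and> Q x) :: nat)" for x by simp
  ultimately show ?thesis unfolding decidable_def by (simp only:)
qed

lemma dec_disj:
  assumes "decidable P" "decidable Q"
  shows "decidable (\<lambda>x. P x \<or> Q x)"
  using dec_not[OF dec_conj[OF dec_not[OF assms(1)] dec_not[OF assms(2)]]] by simp

lemma dec_imp:
  assumes "decidable P" "decidable Q"
  shows "decidable (\<lambda>x. P x \<longrightarrow> Q x)"
  using dec_disj[OF dec_not[OF assms(1)] assms(2)] by (simp only: imp_conv_disj)

lemma dec_iff: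
  assumes "decidable P" "decidable Q"
  shows "decidable (\<lambda>x. P x \<longleftrightarrow> Q x)"
  unfolding iff_conv_conj_imp by (intro dec_conj dec_imp assms)

lemma dec_is_0: "total_computable f \<Longrightarrow> decidable (\<lambda>x. f x = 0)"
proof -
  assume "total_computable f"
  then have "total_computable (\<lambda>x. 1 - f x)" by (intro tc_diff tc_const)
  moreover have "1 - f x = of_bool (f x = 0)" for x by simp
  ultimately show ?thesis unfolding decidable_def by (simp only:)
qed

lemma dec_le:
  assumes "total_computable f" "total_computable g"
  shows "decidable (\<lambda>x. f x \<le> g x)"
  using dec_is_0[OF tc_diff[OF assms]] by simp

lemma dec_less:
  assumes "total_computable f" "total_computable g"
  shows "decidable (\<lambda>x. f x < g x)"
  using dec_not[OF dec_le[OF assms(2,1)]] by (simp add: not_le)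

lemma dec_eq:
  assumes "total_computable f" "total_computable g"
  shows "decidable (\<lambda>x. f x = g x)"
  using dec_conj[OF dec_le[OF assms] dec_le[OF assms(2,1)]] by (simp only: eq_iff)

lemma tc_if:
  assumes "decidable P" "total_computable f" "total_computable g"
  shows "total_computable (\<lambda>x. if P x then f x else g x)"
proof -
  have "total_computable (\<lambda>x. rec_nat (g x) (\<lambda>m r. f x) (of_bool (P x)))"
    by (intro tc_rec assms(3) tc_comp[OF assms(2) tc_pfst[OF tc_id]] assms(1)[unfolded decidable_def])
  moreover have "rec_nat (g x) (\<lambda>m r. f x) (of_bool (P x)) = (if P x then f x else g x)" for x
    by simp
  ultimately show ?thesis by simp
qed

lemma dec_ex_less:
  assumes "total_computable n" "decidable (\<lambda>z. P (pfst z) (psnd z))"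
  shows "decidable (\<lambda>x. \<exists>m<n x. P x m)"
proof -
  have P: "decidable (\<lambda>z. P (pfst z) (pfst (psnd z)))"
    using decidable_comp[OF assms(2) tc_pcode[OF tc_pfst[OF tc_id] tc_pfst[OF tc_psnd[OF tc_id]]]]
    by simp
  have "total_computable (\<lambda>x. rec_nat 0 (\<lambda>m r. if P x m then 1 else r) (n x))"
    by (intro tc_rec tc_const tc_if P assms(1) tc_psnd tc_id)
  moreover have "rec_nat 0 (\<lambda>m r. if P x m then 1 else r) k = of_bool (\<exists>m<k. P x m)" for x k
    by (induction k) (auto simp: less_Suc_eq)
  then have "(\<lambda>x. rec_nat 0 (\<lambda>m r. if P x m then 1 else r) (n x)) = (\<lambda>x. of_bool (\<exists>m<n x. P x m))"
    by blast
  ultimately show ?thesis unfolding decidable_def by (rule back_subst)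
qed

lemma dec_all_less:
  assumes "total_computable n" "decidable (\<lambda>z. P (pfst z) (psnd z))"
  shows "decidable (\<lambda>x. \<forall>m<n x. P x m)"
  using dec_not[OF dec_ex_less[OF assms(1) dec_not[OF assms(2)]]] by simp

lemma dec_ex_le:
  assumes "total_computable n" "decidable (\<lambda>z. P (pfst z) (psnd z))"
  shows "decidable (\<lambda>x. \<exists>m\<le>n x. P x m)"
  using dec_ex_less[OF tc_Suc[OF assms(1)] assms(2)] by (simp add: less_Suc_eq_le)

lemma dec_all_le:
  assumes "total_computable n" "decidable (\<lambda>z. P (pfst z) (psnd z))"
  shows "decidable (\<lambda>x. \<forall>m\<le>n x. P x m)"
  using dec_all_less[OF tc_Suc[OF assms(1)] assms(2)] by (simp add: less_Suc_eq_le)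

lemma eval_Mu_total:
  assumes "\<And>n. eval p (n # xs) = Some (of_bool (\<not> P n))"
  shows "eval (Mu p) xs = (if \<exists>n. P n then Some (LEAST n. P n) else None)"
  using assms by auto

lemma tc_Least:
  assumes P: "decidable (\<lambda>z. P (pfst z) (psnd z))" and ex: "\<And>x. \<exists>n. P x n"
  shows "total_computable (\<lambda>x. LEAST n. P x n)"
proof -
  obtain p where p: "\<And>z. eval p [z] = Some (of_bool (\<not> P (pfst z) (psnd z)))"
    using total_computableE[OF dec_not[OF P, unfolded decidable_def]] by blast
  obtain pp where pp: "\<And>x y. eval pp [x, y] = Some (pcode x y)"
    using total_computable2E[OF tc2_pcode] by blast
  show ?thesis
  proof (rule total_computableI)
    fix x
    have "eval (Comp p [Comp pp [Proj 1, Proj 0]]) (n # [x]) = Some (of_bool (\<not> P x n))" for n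
      by (simp add: p pp)
    from eval_Mu_total[OF this] ex
    show "eval (Mu (Comp p [Comp pp [Proj 1, Proj 0]])) [x] = Some (LEAST n. P x n)"
      by (simp del: eval.simps)
  qed
qed

text \<open>
  A function of several arguments is shown to be computable in its packed form; these rules turn that
  into an introduction rule for arbitrary computable arguments.
\<close>

lemma tc_app2:
  assumes "total_computable (\<lambda>z. F (pfst z) (psnd z))" "total_computable f" "total_computable g"
  shows "total_computable (\<lambda>x. F (f x) (g x))"
  using tc_comp[OF assms(1) tc_pcode[OF assms(2,3)]] by simp

lemma tc_app3:
  assumes "total_computable (\<lambda>z. F (pfst z) (pfst (psnd z)) (psnd (psnd z)))"
    "total_computable f" "total_computable g" "total_computable h"
  shows "total_computable (\<lambda>x. F (f x) (g x) (h x))"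
  using tc_comp[OF assms(1) tc_pcode[OF assms(2) tc_pcode[OF assms(3,4)]]] by simp

lemma tc_app4:
  assumes "total_computable (\<lambda>z. F (pfst z) (pfst (psnd z)) (pfst (psnd (psnd z))) (psnd (psnd (psnd z))))"
    "total_computable f" "total_computable g" "total_computable h" "total_computable k"
  shows "total_computable (\<lambda>x. F (f x) (g x) (h x) (k x))"
  using tc_comp[OF assms(1) tc_pcode[OF assms(2) tc_pcode[OF assms(3) tc_pcode[OF assms(4,5)]]]]
  by simp

lemmas dec_app2 = tc_app2[where F = "\<lambda>x y. of_bool (P x y)" for P, folded decidable_def]
lemmas dec_app3 = tc_app3[where F = "\<lambda>x y z. of_bool (P x y z)" for P, folded decidable_def]

named_theorems computable_intros
lemmas [computable_intros] =
  tc_id tc_const tc_Suc tc_add tc_diff tc_pcode tc_pfst tc_psnd tc_if tc_rec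
  dec_not dec_conj dec_disj dec_imp dec_iff dec_le dec_less dec_eq
  dec_ex_less dec_ex_le dec_all_less dec_all_le

subsection \<open>Lists and course-of-values recursion\<close>

definition list_drop :: "nat \<Rightarrow> nat \<Rightarrow> nat" where
  "list_drop n c = rec_nat c (\<lambda>_ r. psnd (r - 1)) n"

text \<open>
  Shifted by one: the value 0 says that the list is too short.
\<close>

definition list_entry :: "nat \<Rightarrow> nat \<Rightarrow> nat" where
  "list_entry c n = (if list_drop n c = 0 then 0 else Suc (pfst (list_drop n c - 1)))"

lemma list_encode_Cons: "list_encode (x # xs) = Suc (pcode x (list_encode xs))"
  by (simp add: pcode_def)

lemma list_drop_list_encode: "list_drop n (list_encode xs) = list_encode (drop n xs)"
proof (induction n arbitrary: xs)
  case 0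
  show ?case by (simp add: list_drop_def)
next
  case (Suc n)
  have "list_drop (Suc n) (list_encode xs) = psnd (list_encode (drop n xs) - 1)"
    using Suc by (simp add: list_drop_def)
  also have "\<dots> = list_encode (drop (Suc n) xs)"
  proof (cases "drop n xs")
    case Nil
    then show ?thesis by simp
  next
    case (Cons y ys)
    then have "drop (Suc n) xs = ys" by (metis drop_Suc list.sel(3) tl_drop)
    with Cons show ?thesis by (simp add: list_encode_Cons del: list_encode.simps(2))
  qed
  finally show ?case .
qed

lemma list_entry_list_encode: "list_entry (list_encode xs) n = (if n < length xs then Suc (xs ! n) else 0)"
proof (cases "n < length xs")
  case True
  then have "drop n xs = xs ! n # drop (Suc n) xs" by (simp add: Cons_nth_drop_Suc)
  with True show ?thesis
    by (simp add: list_entry_def list_drop_list_encode list_encode_Cons del: list_encode.simps(2))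
next
  case False
  then show ?thesis by (simp add: list_entry_def list_drop_list_encode)
qed

lemma tc_list_drop': "total_computable (\<lambda>z. list_drop (pfst z) (psnd z))"
  unfolding list_drop_def by (intro computable_intros)
lemmas tc_list_drop [computable_intros] = tc_app2[OF tc_list_drop']

lemma tc_list_entry': "total_computable (\<lambda>z. list_entry (pfst z) (psnd z))"
  unfolding list_entry_def by (intro computable_intros)
lemmas tc_list_entry [computable_intros] = tc_app2[OF tc_list_entry']

text \<open>
  If \<open>H t (history H t)\<close> is taken as the value of a function at \<open>t\<close>, then \<open>history H t\<close> codes the list
  of its values below \<open>t\<close>, the latest first. A definition in this form is a course-of-values recursion.
\<close>

definition history :: "(nat \<Rightarrow> nat \<Rightarrow> nat) \<Rightarrow> nat \<Rightarrow> nat" where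
  "history H t = rec_nat 0 (\<lambda>m r. Suc (pcode (H m r) r)) t"

lemma history_eq: "history H t = list_encode (rev (map (\<lambda>r. H r (history H r)) [0..<t]))"
  by (induction t) (simp_all add: history_def list_encode_Cons del: list_encode.simps(2))

lemma list_entry_history: "r < t \<Longrightarrow> list_entry (history H t) (t - Suc r) = Suc (H r (history H r))"
  by (subst history_eq) (simp add: list_entry_list_encode rev_nth del: upt_Suc)

lemma tc_history:
  assumes "total_computable (\<lambda>z. H (pfst z) (psnd z))" "total_computable f"
  shows "total_computable (\<lambda>x. history H (f x))"
  unfolding history_def
  by (intro tc_rec tc_Suc tc_pcode tc_app2[OF assms(1)] tc_const assms(2) tc_pfst tc_psnd tc_id)

section \<open>A universal machine\<close>

text \<open>
  Evaluation is presented as a deduction system whose judgments are numbers. Two kinds of pseudo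
  programs keep every rule down to at most two premises: a list of programs (tags 4 and 5) evaluates
  to the list of the values, and a bounded test (tag 8) of \<open>p\<close> evaluates to 0 on \<open>n # xs\<close> if \<open>p\<close> has
  nonzero values on \<open>m # xs\<close> for all \<open>m < n\<close>. The number 0 is the judgment that \<open>Zero\<close> has the value 0
  on the empty list; it holds, and serves as the premise of rules that have fewer than two.
\<close>

declare list_encode.simps(2) [simp del] list_encode_Cons [simp]

abbreviation lcons :: "nat \<Rightarrow> nat \<Rightarrow> nat" where "lcons x c \<equiv> Suc (pcode x c)"
abbreviation lhd :: "nat \<Rightarrow> nat" where "lhd c \<equiv> pfst (c - 1)"
abbreviation ltl :: "nat \<Rightarrow> nat" where "ltl c \<equiv> psnd (c - 1)"

primrec lcode :: "nat list \<Rightarrow> nat" where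
  "lcode [] = pcode 4 0"
| "lcode (c # cs) = pcode 5 (pcode c (lcode cs))"

primrec code :: "recf \<Rightarrow> nat" where
  "code Zero = pcode 0 0"
| "code Succ = pcode 1 0"
| "code (Proj i) = pcode 2 i"
| "code (Comp p qs) = pcode 3 (pcode (code p) (lcode (map code qs)))"
| "code (PrimRec p q) = pcode 6 (pcode (code p) (code q))"
| "code (Mu p) = pcode 7 (code p)"

abbreviation assertion :: "nat \<Rightarrow> nat \<Rightarrow> nat \<Rightarrow> nat" where
  "assertion P X Y \<equiv> pcode P (pcode X Y)"
abbreviation prog :: "nat \<Rightarrow> nat" where "prog j \<equiv> pfst j"
abbreviation arg :: "nat \<Rightarrow> nat" where "arg j \<equiv> pfst (psnd j)"
abbreviation res :: "nat \<Rightarrow> nat" where "res j \<equiv> psnd (psnd j)"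

text \<open>
  Judgment \<open>j\<close> follows from \<open>a\<close> and \<open>b\<close> by one rule. Instead of quantifying over the parameters of a rule,
  each disjunct computes them by projections; this makes decidability evident.
\<close>

definition inference :: "nat \<Rightarrow> nat \<Rightarrow> nat \<Rightarrow> bool" where
  "inference j a b \<longleftrightarrow>
    (pfst (prog j) = 0 \<and> res j = 0) \<or>
    (pfst (prog j) = 1 \<and> res j \<noteq> 0 \<and> arg j = lcons (res j - 1) 0) \<or>
    (pfst (prog j) = 2 \<and> psnd (prog j) = 0 \<and> arg j \<noteq> 0 \<and> res j = lhd (arg j)) \<or>
    (pfst (prog j) = 2 \<and> psnd (prog j) \<noteq> 0 \<and> arg j \<noteq> 0
      \<and> a = assertion (pcode 2 (psnd (prog j) - 1)) (ltl (arg j)) (res j)) \<or>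
    (pfst (prog j) = 3 \<and> a = assertion (psnd (psnd (prog j))) (arg j) (res a)
      \<and> b = assertion (pfst (psnd (prog j))) (res a) (res j)) \<or>
    (pfst (prog j) = 4 \<and> res j = 0) \<or>
    (pfst (prog j) = 5 \<and> a = assertion (pfst (psnd (prog j))) (arg j) (res a)
      \<and> b = assertion (psnd (psnd (prog j))) (arg j) (res b) \<and> res j = lcons (res a) (res b)) \<or>
    (pfst (prog j) = 6 \<and> arg j \<noteq> 0 \<and> lhd (arg j) = 0
      \<and> a = assertion (pfst (psnd (prog j))) (ltl (arg j)) (res j)) \<or>
    (pfst (prog j) = 6 \<and> arg j \<noteq> 0 \<and> lhd (arg j) \<noteq> 0
      \<and> a = assertion (prog j) (lcons (lhd (arg j) - 1) (ltl (arg j))) (res a)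
      \<and> b = assertion (psnd (psnd (prog j)))
               (lcons (lhd (arg j) - 1) (lcons (res a) (ltl (arg j)))) (res j)) \<or>
    (pfst (prog j) = 7 \<and> a = assertion (pcode 8 (psnd (prog j))) (lcons (res j) (arg j)) 0
      \<and> b = assertion (psnd (prog j)) (lcons (res j) (arg j)) 0) \<or>
    (pfst (prog j) = 8 \<and> arg j \<noteq> 0 \<and> lhd (arg j) = 0 \<and> res j = 0) \<or>
    (pfst (prog j) = 8 \<and> arg j \<noteq> 0 \<and> lhd (arg j) \<noteq> 0 \<and> res j = 0
      \<and> a = assertion (prog j) (lcons (lhd (arg j) - 1) (ltl (arg j))) 0
      \<and> b = assertion (psnd (prog j)) (lcons (lhd (arg j) - 1) (ltl (arg j))) (res b)
      \<and> res b \<noteq> 0)"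

lemma dec_inference': "decidable (\<lambda>z. inference (pfst z) (pfst (psnd z)) (psnd (psnd z)))"
  unfolding inference_def by (intro computable_intros)

lemmas dec_inference [computable_intros] = dec_app3[OF dec_inference']

text \<open>
  A derivation tree is 0 or the successor of the code of its conclusion and its two subtrees. The
  subtrees are smaller numbers, so that validity is a course-of-values recursion; as entries of a
  history are shifted by one, the truth value 1 of a subtree appears there as 2.
\<close>

definition concl :: "nat \<Rightarrow> nat" where "concl t = pfst (t - 1)"

definition valid_step :: "nat \<Rightarrow> nat \<Rightarrow> nat" where
  "valid_step t h = of_bool (t = 0 \<or>
     (list_entry h (t - Suc (pfst (psnd (t - 1)))) = 2 \<and> list_entry h (t - Suc (psnd (psnd (t - 1)))) = 2
      \<and> inference (concl t) (concl (pfst (psnd (t - 1)))) (concl (psnd (psnd (t - 1))))))"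

definition valid :: "nat \<Rightarrow> bool" where
  "valid t \<longleftrightarrow> valid_step t (history valid_step t) = 1"

lemma valid_0 [simp]: "valid 0"
  by (simp add: valid_def valid_step_def)

lemma valid_node:
  "valid (Suc (pcode j (pcode t u))) \<longleftrightarrow>
     valid t \<and> valid u \<and> inference j (concl t) (concl u)"
proof -
  let ?s = "Suc (pcode j (pcode t u))"
  have "t < ?s" "u < ?s"
    using le_pcode[where a = t and b = u] le_pcode(2)[where a = j and b = "pcode t u"] by simp_all
  then have "list_entry (history valid_step ?s) (?s - Suc t) = Suc (valid_step t (history valid_step t))"
    "list_entry (history valid_step ?s) (?s - Suc u) = Suc (valid_step u (history valid_step u))"
    by (simp_all only: list_entry_history)
  then show ?thesis
    unfolding valid_def by (subst (1) valid_step_def) (simp add: concl_def numeral_2_eq_2)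
qed

lemma concl_node [simp]: "concl (Suc (pcode j z)) = j"
  by (simp add: concl_def)

lemma concl_0 [simp]: "concl 0 = 0"
  by (simp add: concl_def)

lemma tc_concl [computable_intros]: "total_computable f \<Longrightarrow> total_computable (\<lambda>x. concl (f x))"
  unfolding concl_def by (intro computable_intros)

lemma dec_valid [computable_intros]: "total_computable f \<Longrightarrow> decidable (\<lambda>x. valid (f x))"
proof -
  have step: "total_computable (\<lambda>z. valid_step (pfst z) (psnd z))"
    unfolding valid_step_def decidable_def[symmetric] by (intro computable_intros)
  assume "total_computable f"
  then show "decidable (\<lambda>x. valid (f x))"
    unfolding valid_def by (intro dec_eq tc_const tc_app2[OF step] tc_history[OF step])
qed

definition derivable :: "nat \<Rightarrow> bool" where
  "derivable j \<longleftrightarrow> (\<exists>t. valid t \<and> concl t = j)"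

lemma derivable_0: "derivable 0"
  unfolding derivable_def by (intro exI[of _ 0]) simp

lemma derivableI:
  assumes "inference j a b" "derivable a" "derivable b"
  shows "derivable j"
proof -
  obtain t u where "valid t" "concl t = a" "valid u" "concl u = b"
    using assms unfolding derivable_def by blast
  then have "valid (Suc (pcode j (pcode t u)))" using assms(1) by (simp add: valid_node)
  then show ?thesis unfolding derivable_def by (intro exI[of _ "Suc (pcode j (pcode t u))"]) simp
qed

lemma derivable_induct [consumes 1, case_names zero inference]:
  assumes "derivable j" and "P 0"
    and step: "\<And>j a b. inference j a b \<Longrightarrow> P a \<Longrightarrow> P b \<Longrightarrow> P j"
  shows "P j"
proof -
  have "valid t \<Longrightarrow> P (concl t)" for t
  proof (induction t rule: less_induct)
    case (less t)
    show ?case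
    proof (cases t)
      case 0
      then show ?thesis using assms(2) by simp
    next
      case (Suc z)
      define j u v where "j = pfst z" "u = pfst (psnd z)" "v = psnd (psnd z)"
      then have t: "t = Suc (pcode j (pcode u v))" using Suc by simp
      have "u < t" "v < t"
        using le_pcode[where a = u and b = v] le_pcode(2)[where a = j and b = "pcode u v"] t
        by simp_all
      then show ?thesis using less step[of j "concl u" "concl v"] by (simp add: t valid_node)
    qed
  qed
  then show ?thesis using assms(1) unfolding derivable_def by blast
qed

abbreviation computes :: "nat \<Rightarrow> nat list \<Rightarrow> nat \<Rightarrow> bool" where
  "computes P xs y \<equiv> derivable (assertion P (list_encode xs) y)"

lemma computes_Proj: "i < length xs \<Longrightarrow> computes (pcode 2 i) xs (xs ! i)"
proof (induction i arbitrary: xs)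
  case 0
  then obtain x ys where "xs = x # ys" by (cases xs) auto
  then show ?case by (intro derivableI[OF _ derivable_0 derivable_0]) (simp add: inference_def)
next
  case (Suc i)
  then obtain x ys where xs: "xs = x # ys" by (cases xs) auto
  with Suc have "computes (pcode 2 i) ys (ys ! i)" by simp
  from derivableI[OF _ this derivable_0] show ?case by (simp add: xs inference_def)
qed

lemma computes_list:
  assumes "\<And>q. q \<in> set qs \<Longrightarrow> computes (code q) xs (f q)"
  shows "computes (lcode (map code qs)) xs (list_encode (map f qs))"
  using assms
proof (induction qs)
  case Nil
  show ?case by (intro derivableI[OF _ derivable_0 derivable_0]) (simp add: inference_def)
next
  case (Cons q qs)
  then have "computes (code q) xs (f q)" "computes (lcode (map code qs)) xs (list_encode (map f qs))"
    by simp_all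
  from derivableI[OF _ this] show ?case by (simp add: inference_def)
qed

text \<open>
  Completeness of the deduction system: by induction on the program, every evaluation is mirrored by
  a derivation.
\<close>

lemma computes_complete: "eval p xs = Some y \<Longrightarrow> computes (code p) xs y"
proof (induction p arbitrary: xs y)
  case Zero
  then show ?case by (intro derivableI[OF _ derivable_0 derivable_0]) (simp add: inference_def)
next
  case Succ
  then obtain x where "xs = [x]" "y = Suc x" by (auto split: list.splits)
  then show ?case by (intro derivableI[OF _ derivable_0 derivable_0]) (simp add: inference_def)
next
  case (Proj i)
  then have "i < length xs" "y = xs ! i" by (auto split: if_splits)
  then show ?case using computes_Proj by simp
next
  case (Comp p qs)
  define f where "f q = the (eval q xs)" for q
  from Comp.prems have qs: "\<forall>q\<in>set qs. eval q xs \<noteq> None" and p: "eval p (map f qs) = Some y"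
    by (auto simp: f_def[abs_def] split: if_splits)
  from qs have "computes (code q) xs (f q)" if "q \<in> set qs" for q
    using that Comp.IH(2) by (auto simp: f_def)
  then have "computes (lcode (map code qs)) xs (list_encode (map f qs))" by (rule computes_list)
  from derivableI[OF _ this Comp.IH(1)[OF p]] show ?case by (simp add: inference_def)
next
  case (PrimRec p q)
  then obtain n ys where xs: "xs = n # ys" by (auto split: list.splits)
  have "eval (PrimRec p q) (n # ys) = Some y \<Longrightarrow> computes (code (PrimRec p q)) (n # ys) y" for y
  proof (induction n arbitrary: y)
    case 0
    then have "computes (code p) ys y" using PrimRec.IH(1) by simp
    from derivableI[OF _ this derivable_0] show ?case by (simp add: inference_def)
  next
    case (Suc n)
    from Suc.prems obtain v where v: "eval (PrimRec p q) (n # ys) = Some v"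
      and q: "eval q (n # v # ys) = Some y"
      by (auto split: option.splits)
    from derivableI[OF _ Suc.IH[OF v] PrimRec.IH(2)[OF q]] show ?case by (simp add: inference_def)
  qed
  then show ?case using PrimRec.prems unfolding xs by blast
next
  case (Mu p)
  from Mu.prems have ex: "\<exists>n. eval p (n # xs) = Some 0 \<and> (\<forall>m<n. eval p (m # xs) \<noteq> None)"
    and y: "y = (LEAST n. eval p (n # xs) = Some 0)" by (auto split: if_splits)
  then obtain n where n: "eval p (n # xs) = Some 0" "\<forall>m<n. eval p (m # xs) \<noteq> None" by blast
  have y0: "eval p (y # xs) = Some 0" unfolding y by (rule LeastI[of _ n]) (rule n)
  have "y \<le> n" unfolding y by (rule Least_le) (rule n)
  have "\<exists>v. eval p (m # xs) = Some (Suc v)" if "m < y" for m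
  proof -
    have "eval p (m # xs) \<noteq> None" using n(2) that \<open>y \<le> n\<close> by simp
    moreover have "eval p (m # xs) \<noteq> Some 0" using not_less_Least[of m] that y by blast
    ultimately show ?thesis by (metis not0_implies_Suc option.exhaust)
  qed
  moreover have "computes (pcode 8 (code p)) (k # xs) 0"
    if "\<And>m. m < k \<Longrightarrow> \<exists>v. eval p (m # xs) = Some (Suc v)" for k
    using that
  proof (induction k)
    case 0
    show ?case by (intro derivableI[OF _ derivable_0 derivable_0]) (simp add: inference_def)
  next
    case (Suc k)
    obtain v where "eval p (k # xs) = Some (Suc v)" using Suc.prems by blast
    from Mu.IH[OF this] have v: "computes (code p) (k # xs) (Suc v)" .
    have "computes (pcode 8 (code p)) (k # xs) 0" using Suc by simp
    from derivableI[OF _ this v] show ?case by (simp add: inference_def)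
  qed
  ultimately have "computes (pcode 8 (code p)) (y # xs) 0" by blast
  from derivableI[OF _ this Mu.IH[OF y0]] show ?case by (simp add: inference_def)
qed

text \<open>
  The intended meaning of a judgment. It says nothing about numbers that code neither a program nor a
  pseudo program.
\<close>

definition sound :: "nat \<Rightarrow> bool" where
  "sound j \<longleftrightarrow>
     (\<forall>p. prog j = code p \<longrightarrow> eval p (list_decode (arg j)) = Some (res j)) \<and>
     (\<forall>ps. prog j = lcode (map code ps) \<longrightarrow>
        (\<forall>p\<in>set ps. eval p (list_decode (arg j)) \<noteq> None) \<and>
        list_decode (res j) = map (\<lambda>p. the (eval p (list_decode (arg j)))) ps) \<and>
     (\<forall>p. prog j = pcode 8 (code p) \<longrightarrow>
        (\<exists>n xs. list_decode (arg j) = n # xs \<and> (\<forall>m<n. \<exists>v. eval p (m # xs) = Some (Suc v))))"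

lemma nonempty_list_code:
  assumes "c \<noteq> 0"
  shows "list_decode c = lhd c # list_decode (ltl c)"
  using assms by (cases c) (auto simp: pfst_def psnd_def split: prod.splits)

declare list_decode.simps(2) [simp del]

lemma list_decode_lcons [simp]: "list_decode (lcons x c) = x # list_decode c"
  by (subst nonempty_list_code) simp_all

lemma sound_codeD: "sound j \<Longrightarrow> prog j = code p \<Longrightarrow> eval p (list_decode (arg j)) = Some (res j)"
  by (simp add: sound_def)

lemma sound_lcodeD:
  assumes "sound j" "prog j = lcode (map code ps)"
  shows "\<forall>p\<in>set ps. eval p (list_decode (arg j)) \<noteq> None"
    and "list_decode (res j) = map (\<lambda>p. the (eval p (list_decode (arg j)))) ps"
  using assms unfolding sound_def by metis+

lemma sound_MuD:
  assumes "sound j" "prog j = pcode 8 (code p)"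
  shows "\<exists>n xs. list_decode (arg j) = n # xs \<and> (\<forall>m<n. \<exists>v. eval p (m # xs) = Some (Suc v))"
  using assms unfolding sound_def by metis

lemma inference_sound:
  assumes j: "inference j a b" and a: "sound a" and b: "sound b"
  shows "sound j"
proof -
  have "eval p (list_decode (arg j)) = Some (res j)" if p: "prog j = code p" for p
  proof (cases p)
    case Zero
    then show ?thesis using j p by (auto simp: inference_def)
  next
    case Succ
    then show ?thesis using j p by (auto simp: inference_def)
  next
    case (Proj i)
    have "(i = 0 \<and> arg j \<noteq> 0 \<and> res j = lhd (arg j)) \<or>
      (i \<noteq> 0 \<and> arg j \<noteq> 0 \<and> a = assertion (code (recf.Proj (i - 1))) (ltl (arg j)) (res j))"
      using j p Proj by (auto simp: inference_def)
    then show ?thesis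
    proof (elim disjE conjE)
      assume *: "i \<noteq> 0" "arg j \<noteq> 0" "a = assertion (code (recf.Proj (i - 1))) (ltl (arg j)) (res j)"
      have "eval (recf.Proj (i - 1)) (list_decode (ltl (arg j))) = Some (res j)"
        using a unfolding sound_def *(3) by (simp del: code.simps eval.simps)
      then show ?thesis
        unfolding nonempty_list_code[OF *(2)] using *(1) Proj by (auto split: if_splits)
    next
      assume "i = 0" "arg j \<noteq> 0" "res j = lhd (arg j)"
      then show ?thesis unfolding nonempty_list_code[OF \<open>arg j \<noteq> 0\<close>] by (simp add: Proj)
    qed
  next
    case (Comp q qs)
    then have "a = assertion (lcode (map code qs)) (arg j) (res a)"
      "b = assertion (code q) (res a) (res j)"
      using j p by (auto simp: inference_def)
    then have pa: "prog a = lcode (map code qs)" "arg a = arg j"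
      and pb: "prog b = code q" "arg b = res a" "res b = res j"
      by (metis pfst_pcode psnd_pcode)+
    have "eval q (list_decode (res a)) = Some (res j)"
      using sound_codeD[OF b pb(1)] pb by simp
    then show ?thesis using sound_lcodeD[OF a pa(1)] pa(2) Comp by simp
  next
    case (PrimRec q r)
    then have prog: "prog j = pcode 6 (pcode (code q) (code r))" using p by simp
    have arg: "arg j \<noteq> 0" using j prog by (auto simp: inference_def)
    let ?n = "lhd (arg j)" and ?ys = "list_decode (ltl (arg j))"
    show ?thesis
    proof (cases "?n = 0")
      case True
      then have "a = assertion (code q) (ltl (arg j)) (res j)"
        using j prog by (auto simp: inference_def)
      then have "eval q ?ys = Some (res j)" using sound_codeD[OF a, of q] by simp
      then show ?thesis unfolding nonempty_list_code[OF arg] using True PrimRec by simp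
    next
      case False
      then have "a = assertion (prog j) (lcons (?n - 1) (ltl (arg j))) (res a)"
        "b = assertion (code r) (lcons (?n - 1) (lcons (res a) (ltl (arg j)))) (res j)"
        using j prog by (auto simp: inference_def)
      then have pa: "prog a = code p" "arg a = lcons (?n - 1) (ltl (arg j))"
        and pb: "prog b = code r" "arg b = lcons (?n - 1) (lcons (res a) (ltl (arg j)))"
          "res b = res j"
        using p by (metis pfst_pcode psnd_pcode)+
      obtain n where n: "?n = Suc n" using False not0_implies_Suc by blast
      have "eval (PrimRec q r) (n # ?ys) = Some (res a)"
        using sound_codeD[OF a pa(1)] unfolding pa(2) PrimRec n by (simp del: eval.simps)
      moreover have "eval r (n # res a # ?ys) = Some (res j)"
        using sound_codeD[OF b pb(1)] unfolding pb(2,3) n by simp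
      ultimately show ?thesis unfolding nonempty_list_code[OF arg] n PrimRec by simp
    qed
  next
    case (Mu q)
    then have prog: "prog j = pcode 7 (code q)" using p by simp
    then have "a = assertion (pcode 8 (code q)) (lcons (res j) (arg j)) 0"
      "b = assertion (code q) (lcons (res j) (arg j)) 0"
      using j by (auto simp: inference_def)
    then have less: "\<forall>m<res j. \<exists>v. eval q (m # list_decode (arg j)) = Some (Suc v)"
      and eq: "eval q (res j # list_decode (arg j)) = Some 0"
      using sound_MuD[OF a, of q] sound_codeD[OF b, of q] by auto
    have "(LEAST n. eval q (n # list_decode (arg j)) = Some 0) = res j"
    proof (rule Least_equality)
      show "eval q (res j # list_decode (arg j)) = Some 0" by (rule eq)
    next
      fix n assume "eval q (n # list_decode (arg j)) = Some 0"
      then show "res j \<le> n" using less by (metis not_less option.inject Zero_not_Suc)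
    qed
    moreover have "\<forall>m<res j. eval q (m # list_decode (arg j)) \<noteq> None"
      using less by fastforce
    ultimately show ?thesis using eq Mu by auto
  qed
  moreover have "(\<forall>p\<in>set ps. eval p (list_decode (arg j)) \<noteq> None) \<and>
        list_decode (res j) = map (\<lambda>p. the (eval p (list_decode (arg j)))) ps"
    if p: "prog j = lcode (map code ps)" for ps
  proof (cases ps)
    case Nil
    then have "prog j = pcode 4 0" using p by simp
    then have "res j = 0" using j by (auto simp: inference_def)
    then show ?thesis using Nil by simp
  next
    case (Cons q qs)
    then have "prog j = pcode 5 (pcode (code q) (lcode (map code qs)))" using p by simp
    then have "a = assertion (code q) (arg j) (res a)" "res j = lcons (res a) (res b)"
      "b = assertion (lcode (map code qs)) (arg j) (res b)"
      using j by (auto simp: inference_def)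
    then have pa: "prog a = code q" "arg a = arg j" and r: "res j = lcons (res a) (res b)"
      and pb: "prog b = lcode (map code qs)" "arg b = arg j"
      by (metis pfst_pcode psnd_pcode)+
    show ?thesis using sound_codeD[OF a pa(1)] sound_lcodeD[OF b pb(1)] pa(2) pb(2)
      unfolding r Cons by simp
  qed
  moreover have "\<exists>n xs. list_decode (arg j) = n # xs \<and> (\<forall>m<n. \<exists>v. eval p (m # xs) = Some (Suc v))"
    if p: "prog j = pcode 8 (code p)" for p
  proof -
    have arg: "arg j \<noteq> 0" using j p by (auto simp: inference_def)
    let ?n = "lhd (arg j)" and ?xs = "list_decode (ltl (arg j))"
    have "\<forall>m<?n. \<exists>v. eval p (m # ?xs) = Some (Suc v)"
    proof (cases ?n)
      case (Suc n)
      then have "a = assertion (pcode 8 (code p)) (lcons n (ltl (arg j))) 0"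
        "b = assertion (code p) (lcons n (ltl (arg j))) (res b)" "res b \<noteq> 0"
        using j p by (auto simp: inference_def)
      then have pa: "prog a = pcode 8 (code p)" "arg a = lcons n (ltl (arg j))"
        and pb: "prog b = code p" "arg b = lcons n (ltl (arg j))" "res b \<noteq> 0"
        by (metis pfst_pcode psnd_pcode)+
      have "\<forall>m<n. \<exists>v. eval p (m # ?xs) = Some (Suc v)"
        using sound_MuD[OF a pa(1)] pa(2) by simp
      moreover have "\<exists>v. eval p (n # ?xs) = Some (Suc v)"
        using sound_codeD[OF b pb(1)] pb(2,3) by (simp add: not0_implies_Suc)
      ultimately show ?thesis unfolding Suc by (auto simp: less_Suc_eq)
    qed simp
    then show ?thesis unfolding nonempty_list_code[OF arg] by blast
  qed
  ultimately show ?thesis unfolding sound_def by blast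
qed

lemma pcode_eq_0_iff [simp]: "pcode a b = 0 \<longleftrightarrow> a = 0 \<and> b = 0"
  using pcode_eq_iff[of a b 0 0] by (simp only: pcode_0_0)

lemma sound_0: "sound 0"
proof -
  have "p = Zero" if "0 = code p" for p
    using that by (cases p) simp_all
  moreover have "0 \<noteq> lcode ps" "0 \<noteq> pcode 8 n" for ps n
    by (cases ps) simp_all
  ultimately show ?thesis
    unfolding sound_def pfst_0 psnd_0 by fastforce
qed

lemma computes_sound:
  assumes "computes (code p) xs y"
  shows "eval p xs = Some y"
proof -
  have "sound (assertion (code p) (list_encode xs) y)"
    using assms by (induction rule: derivable_induct) (rule sound_0, rule inference_sound)
  from sound_codeD[OF this] show ?thesis by simp
qed

subsection \<open>Halting computations\<close>

definition halts :: "nat \<Rightarrow> nat \<Rightarrow> nat \<Rightarrow> bool" where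
  "halts d x t \<longleftrightarrow> valid t \<and> concl t = assertion d (lcons x 0) (res (concl t))"

definition outcome :: "nat \<Rightarrow> nat" where
  "outcome t = res (concl t)"

lemma halts_code:
  "halts (code p) x t \<Longrightarrow> eval p [x] = Some (outcome t)"
  "eval p [x] = Some y \<Longrightarrow> \<exists>t. halts (code p) x t"
proof -
  assume "halts (code p) x t"
  then have "computes (code p) [x] (outcome t)"
    unfolding derivable_def halts_def outcome_def by (intro exI[of _ t]) simp
  then show "eval p [x] = Some (outcome t)" by (rule computes_sound)
next
  assume "eval p [x] = Some y"
  from computes_complete[OF this] obtain t where
    "valid t" "concl t = assertion (code p) (list_encode [x]) y"
    unfolding derivable_def by blast
  then have "halts (code p) x t" unfolding halts_def by simp
  then show "\<exists>t. halts (code p) x t" ..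
qed

text \<open>
  A computation may have many derivation trees; its halting time is the least one.
\<close>

definition halts_at :: "nat \<Rightarrow> nat \<Rightarrow> nat \<Rightarrow> bool" where
  "halts_at d x t \<longleftrightarrow> halts d x t \<and> (\<forall>u<t. \<not> halts d x u)"

lemma halts_at_unique: "halts_at d x t \<Longrightarrow> halts_at d x u \<Longrightarrow> t = u"
  unfolding halts_at_def by (meson linorder_neqE_nat)

lemma halts_at_ex: "halts d x t \<Longrightarrow> \<exists>u. halts_at d x u"
  unfolding halts_at_def using exists_least_iff[of "halts d x"] by blast

lemma halts_at_code:
  "eval p [x] = Some y \<longleftrightarrow> (\<exists>t. halts_at (code p) x t \<and> outcome t = y)"
  using halts_code[of p x] halts_at_ex[of "code p" x]
  by (metis halts_at_def option.inject)

lemma dec_halts: "decidable (\<lambda>z. halts (pfst z) (pfst (psnd z)) (psnd (psnd z)))"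
  unfolding halts_def by (intro computable_intros)

lemma dec_halts_at: "decidable (\<lambda>z. halts_at (pfst z) (pfst (psnd z)) (psnd (psnd z)))"
  unfolding halts_at_def by (intro computable_intros dec_app3[OF dec_halts])

lemmas [computable_intros] = dec_app3[OF dec_halts_at]

lemma tc_outcome [computable_intros]:
  "total_computable f \<Longrightarrow> total_computable (\<lambda>x. outcome (f x))"
  unfolding outcome_def by (intro computable_intros)

section \<open>Stagewise approximation\<close>

text \<open>
  Values of approximations are shifted by one: 0 stands for a value that is not yet known, and
  \<open>Suc y\<close> for the value \<open>y\<close>.
\<close>

declare neq0_conv [iff del]

definition limit :: "(nat \<Rightarrow> nat \<Rightarrow> nat) \<Rightarrow> nat \<Rightarrow> nat option" where
  "limit A x = (if \<exists>t. A t x \<noteq> 0 then Some (A (LEAST t. A t x \<noteq> 0) x - 1) else None)"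

definition growing :: "(nat \<Rightarrow> nat \<Rightarrow> nat) \<Rightarrow> bool" where
  "growing A \<longleftrightarrow> (\<forall>s t x. s \<le> t \<longrightarrow> A s x \<noteq> 0 \<longrightarrow> A t x = A s x)"

lemma growingD: "growing A \<Longrightarrow> A s x \<noteq> 0 \<Longrightarrow> s \<le> t \<Longrightarrow> A t x = A s x"
  by (simp add: growing_def)

lemma limit_None_iff: "limit A x = None \<longleftrightarrow> (\<forall>t. A t x = 0)"
  by (simp add: limit_def)

lemma limit_Some_iff:
  assumes "growing A"
  shows "limit A x = Some y \<longleftrightarrow> (\<exists>t. A t x = Suc y)"
proof
  assume "limit A x = Some y"
  then have ex: "\<exists>t. A t x \<noteq> 0" and y: "y = A (LEAST t. A t x \<noteq> 0) x - 1"
    by (auto simp: limit_def split: if_splits)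
  from LeastI_ex[OF ex] y have "A (LEAST t. A t x \<noteq> 0) x = Suc y" by simp
  then show "\<exists>t. A t x = Suc y" ..
next
  assume "\<exists>t. A t x = Suc y"
  then obtain t where t: "A t x = Suc y" ..
  let ?s = "LEAST t. A t x \<noteq> 0"
  have "A ?s x \<noteq> 0" "?s \<le> t"
    using t LeastI[of "\<lambda>t. A t x \<noteq> 0" t] Least_le[of "\<lambda>t. A t x \<noteq> 0" t] by simp_all
  then have "A ?s x = Suc y" using growingD[OF assms] t by metis
  moreover from t have "\<exists>t. A t x \<noteq> 0" by (metis nat.distinct(1))
  ultimately show "limit A x = Some y" by (simp add: limit_def)
qed

fun option_code :: "nat option \<Rightarrow> nat" where
  "option_code None = 0"
| "option_code (Some y) = Suc y"

lemma option_code_eq_iff [simp]: "option_code u = option_code v \<longleftrightarrow> u = v"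
  by (cases u; cases v) auto

lemma limit_reached:
  assumes "growing A"
  shows "\<exists>s. \<forall>t\<ge>s. A t x = option_code (limit A x)"
proof (cases "limit A x")
  case None
  then have "\<forall>t. A t x = 0" by (simp add: limit_None_iff)
  with None show ?thesis by simp
next
  case (Some y)
  then obtain s where "A s x = Suc y" using limit_Some_iff[OF assms] by blast
  then show ?thesis using growingD[OF assms, of s x] Some by (metis nat.distinct(1) option_code.simps(2))
qed

lemma limit_reached_below:
  assumes "growing A"
  shows "\<exists>s. \<forall>t\<ge>s. \<forall>x<n. A t x = option_code (limit A x)"
proof (induction n)
  case (Suc n)
  then obtain s where s: "\<forall>t\<ge>s. \<forall>x<n. A t x = option_code (limit A x)" ..
  obtain r where r: "\<forall>t\<ge>r. A t n = option_code (limit A n)" using limit_reached[OF assms] ..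
  have "\<forall>t\<ge>max r s. \<forall>x<Suc n. A t x = option_code (limit A x)" using s r by (auto simp: less_Suc_eq)
  then show ?case ..
qed simp

text \<open>
  The search is cut off at \<open>s\<close>, so that it always ends.
\<close>

definition first_halt :: "nat \<Rightarrow> nat \<Rightarrow> nat \<Rightarrow> nat" where
  "first_halt d s x = (LEAST u. u = s \<or> halts_at d x u)"

text \<open>
  The point \<open>x\<close> enters the approximation of program \<open>d\<close> right after stage \<open>pcode x u\<close>, where \<open>u\<close> is the
  halting time on \<open>x\<close>. As \<open>pcode\<close> is injective, at most one point enters at each stage.
\<close>

definition stage :: "nat \<Rightarrow> nat \<Rightarrow> nat \<Rightarrow> nat" where
  "stage d s x = (if pcode x (first_halt d s x) < s then Suc (outcome (first_halt d s x)) else 0)"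

lemma first_halt_eq:
  assumes "halts_at d x u" "u < s"
  shows "first_halt d s x = u"
  unfolding first_halt_def
proof (rule Least_equality)
  show "u = s \<or> halts_at d x u" using assms by simp
next
  fix v assume "v = s \<or> halts_at d x v"
  then show "u \<le> v" using assms halts_at_unique by fastforce
qed

lemma stage_eq_Suc_iff:
  "stage d s x = Suc y \<longleftrightarrow> (\<exists>u. halts_at d x u \<and> pcode x u < s \<and> outcome u = y)"
proof
  assume *: "stage d s x = Suc y"
  let ?u = "first_halt d s x"
  from * have u: "pcode x ?u < s" "outcome ?u = y" by (auto simp: stage_def split: if_splits)
  then have "?u \<noteq> s" using le_pcode(2)[where a = x and b = ?u] by simp
  moreover have "?u = s \<or> halts_at d x ?u" unfolding first_halt_def
    by (rule LeastI[of "\<lambda>u. u = s \<or> halts_at d x u" s]) simp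
  ultimately show "\<exists>u. halts_at d x u \<and> pcode x u < s \<and> outcome u = y" using u by blast
next
  assume "\<exists>u. halts_at d x u \<and> pcode x u < s \<and> outcome u = y"
  then obtain u where u: "halts_at d x u" "pcode x u < s" "outcome u = y" by blast
  then have "first_halt d s x = u"
    using first_halt_eq le_pcode(2)[where a = x and b = u] by simp
  then show "stage d s x = Suc y" using u by (simp add: stage_def)
qed

lemma stage_nonzero_iff: "stage d s x \<noteq> 0 \<longleftrightarrow> (\<exists>u. halts_at d x u \<and> pcode x u < s)"
  by (metis stage_eq_Suc_iff not0_implies_Suc nat.distinct(1))

lemma growing_stage: "growing (stage d)"
  unfolding growing_def
proof (intro allI impI)
  fix s t x assume "s \<le> t" "stage d s x \<noteq> 0"
  then obtain y where y: "stage d s x = Suc y" using not0_implies_Suc by blast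
  with \<open>s \<le> t\<close> have "stage d t x = Suc y" unfolding stage_eq_Suc_iff by (metis order_less_le_trans)
  with y show "stage d t x = stage d s x" by simp
qed

lemma stage_bound: "stage d s x \<noteq> 0 \<Longrightarrow> x < s"
  unfolding stage_nonzero_iff using le_pcode(1) order_le_less_trans by blast

lemma limit_stage_code: "limit (stage (code p)) x = eval p [x]"
proof (cases "eval p [x]")
  case None
  then have "\<not> halts_at (code p) x t" for t using halts_at_code[of p x] by auto
  then show ?thesis using stage_nonzero_iff[of "code p"] None by (auto simp: limit_None_iff)
next
  case (Some y)
  then obtain t where "halts_at (code p) x t" "outcome t = y" using halts_at_code by blast
  then have "stage (code p) (Suc (pcode x t)) x = Suc y" unfolding stage_eq_Suc_iff by blast
  then show ?thesis unfolding Some limit_Some_iff[OF growing_stage] ..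
qed

lemma stage_one_new:
  assumes "stage d s x = 0" "stage d (Suc s) x \<noteq> 0" "stage d s y = 0" "stage d (Suc s) y \<noteq> 0"
  shows "x = y"
proof -
  obtain u v where "pcode x u = s" "pcode y v = s"
    using assms stage_nonzero_iff by (metis less_Suc_eq)
  then have "pcode x u = pcode y v" by simp
  then show ?thesis by simp
qed

lemma tc_stage': "total_computable (\<lambda>z. stage (pfst z) (pfst (psnd z)) (psnd (psnd z)))"
proof -
  have "total_computable (\<lambda>z. first_halt (pfst z) (pfst (psnd z)) (psnd (psnd z)))"
    unfolding first_halt_def by (intro tc_Least computable_intros) blast
  note tc_app3[OF this, computable_intros]
  show ?thesis unfolding stage_def by (intro computable_intros)
qed

lemmas tc_stage [computable_intros] = tc_app3[OF tc_stage']

section \<open>A numbering of the functions that are not odd lists\<close>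

definition lookup :: "nat list \<Rightarrow> nat \<Rightarrow> nat option" where
  "lookup l x = (if x < length l then Some (l ! x) else None)"

lemma lookup_inject [simp]: "lookup l = lookup m \<longleftrightarrow> l = m"
proof
  assume eq: "lookup l = lookup m"
  have "x < length l \<longleftrightarrow> x < length m" for x
    using fun_cong[OF eq, of x] by (auto simp: lookup_def split: if_splits)
  then have len: "length l = length m" by (meson linorder_neqE_nat less_irrefl)
  have "l ! x = m ! x" if "x < length l" for x
    using fun_cong[OF eq, of x] that len by (simp add: lookup_def)
  with len show "l = m" by (rule nth_equalityI)
qed simp

definition odd_list :: "(nat \<Rightarrow> nat option) \<Rightarrow> bool" where
  "odd_list f \<longleftrightarrow> (\<exists>l. odd (length l) \<and> f = lookup l)"

definition odd_stage :: "nat \<Rightarrow> nat \<Rightarrow> bool" where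
  "odd_stage d s \<longleftrightarrow> (\<exists>k\<le>s. \<forall>x\<le>s. stage d s x \<noteq> 0 \<longleftrightarrow> x < Suc (k + k))"

lemma odd_stage_iff: "odd_stage d s \<longleftrightarrow> (\<exists>k. \<forall>x. stage d s x \<noteq> 0 \<longleftrightarrow> x < Suc (k + k))"
proof
  assume "odd_stage d s"
  then obtain k where k: "\<forall>x\<le>s. stage d s x \<noteq> 0 \<longleftrightarrow> x < Suc (k + k)"
    unfolding odd_stage_def by blast
  have "Suc (k + k) \<le> s" using k stage_bound[of d s s] by (metis le_refl less_irrefl not_less)
  then have "stage d s x \<noteq> 0 \<longleftrightarrow> x < Suc (k + k)" for x
    using k stage_bound[of d s x] by (cases "x \<le> s") auto
  then show "\<exists>k. \<forall>x. stage d s x \<noteq> 0 \<longleftrightarrow> x < Suc (k + k)" by blast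
next
  assume "\<exists>k. \<forall>x. stage d s x \<noteq> 0 \<longleftrightarrow> x < Suc (k + k)"
  then obtain k where k: "\<forall>x. stage d s x \<noteq> 0 \<longleftrightarrow> x < Suc (k + k)" by blast
  then have "k < s" using stage_bound[of d s k] by simp
  then show "odd_stage d s" unfolding odd_stage_def using k by (meson less_imp_le)
qed

text \<open>
  A stage and its successor cannot be odd lists of different lengths, as these would differ by at
  least two points.
\<close>

lemma odd_stage_Suc:
  assumes "\<forall>x. stage d s x \<noteq> 0 \<longleftrightarrow> x < Suc (k + k)" "odd_stage d (Suc s)"
  shows "\<forall>x. stage d (Suc s) x \<noteq> 0 \<longleftrightarrow> x < Suc (k + k)"
proof -
  obtain m where m: "\<forall>x. stage d (Suc s) x \<noteq> 0 \<longleftrightarrow> x < Suc (m + m)"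
    using assms(2) odd_stage_iff by blast
  have "k \<le> m"
  proof -
    have "stage d s (k + k) \<noteq> 0" using assms(1) by simp
    then have "stage d (Suc s) (k + k) \<noteq> 0" using growingD[OF growing_stage, of d s "k + k" "Suc s"] by simp
    then show ?thesis using m by simp
  qed
  moreover have "\<not> k < m"
  proof
    assume "k < m"
    have "stage d s x = 0" if "Suc (k + k) \<le> x" for x
      using assms(1) that by (metis not_less)
    then have old: "stage d s (Suc (k + k)) = 0" "stage d s (Suc (Suc (k + k))) = 0" by simp_all
    have "stage d (Suc s) x \<noteq> 0" if "x < Suc (m + m)" for x
      using m that by blast
    then have new: "stage d (Suc s) (Suc (k + k)) \<noteq> 0" "stage d (Suc s) (Suc (Suc (k + k))) \<noteq> 0"
      using \<open>k < m\<close> by simp_all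
    from stage_one_new[OF old(1) new(1) old(2) new(2)]
    show False by simp
  qed
  ultimately show ?thesis using m by simp
qed

text \<open>
  The points of an approximation are published only at stages at which it is not an odd list. Hence
  what is published in the end is never an odd list, and nothing is lost unless all late stages are
  odd lists; these then have the same length, and the function itself is an odd list.
\<close>

definition published :: "nat \<Rightarrow> nat \<Rightarrow> nat \<Rightarrow> nat" where
  "published d s x = (if \<exists>r\<le>s. \<not> odd_stage d r \<and> stage d r x \<noteq> 0 then stage d s x else 0)"

lemma published_nonzeroE:
  assumes "published d s x \<noteq> 0"
  obtains r where "r \<le> s" "\<not> odd_stage d r" "stage d r x \<noteq> 0" "published d s x = stage d s x"
  using assms that unfolding published_def by (metis (full_types))

lemma growing_published: "growing (published d)"
  unfolding growing_def
proof (intro allI impI)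
  fix s t x assume st: "s \<le> t" and nz: "published d s x \<noteq> 0"
  from nz obtain r where r: "r \<le> s" "\<not> odd_stage d r" "stage d r x \<noteq> 0" "published d s x = stage d s x"
    by (rule published_nonzeroE)
  with st have "published d t x = stage d t x" unfolding published_def by (metis le_trans)
  also have "\<dots> = stage d s x" using growingD[OF growing_stage _ st] nz r(4) by metis
  finally show "published d t x = published d s x" using r(4) by simp
qed

lemma published_bound: "published d s x \<noteq> 0 \<Longrightarrow> x < s"
  using stage_bound[of d s x] by (auto simp: published_def split: if_splits)

lemma limit_published:
  assumes "\<not> odd_list (limit (stage d))"
  shows "limit (published d) = limit (stage d)"
proof
  fix x
  show "limit (published d) x = limit (stage d) x"
  proof (cases "limit (stage d) x")
    case None
    then have "\<forall>t. published d t x = 0" by (simp add: limit_None_iff published_def)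
    then have "limit (published d) x = None" by (simp add: limit_None_iff)
    with None show ?thesis by simp
  next
    case (Some y)
    then obtain s where s: "stage d s x = Suc y" using limit_Some_iff[OF growing_stage] by blast
    have "\<exists>r\<ge>s. \<not> odd_stage d r"
    proof (rule ccontr)
      assume "\<not> (\<exists>r\<ge>s. \<not> odd_stage d r)"
      then have odd: "odd_stage d r" if "r \<ge> s" for r using that by blast
      obtain k where k: "\<forall>x. stage d s x \<noteq> 0 \<longleftrightarrow> x < Suc (k + k)"
        using odd[of s] odd_stage_iff by blast
      have "\<forall>x. stage d r x \<noteq> 0 \<longleftrightarrow> x < Suc (k + k)" if "r \<ge> s" for r
        using that by (induction r rule: dec_induct) (use k odd odd_stage_Suc in auto)
      then have "stage d r x \<noteq> 0 \<longrightarrow> x < Suc (k + k)" for r x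
        using growingD[OF growing_stage, of d r x "max r s"] by (metis max.cobounded1 max.cobounded2)
      then have dom: "limit (stage d) x \<noteq> None \<longleftrightarrow> x < Suc (k + k)" for x
        using k by (auto simp: limit_None_iff)
      have "limit (stage d) = lookup (map (\<lambda>x. the (limit (stage d) x)) [0..<Suc (k + k)])"
      proof
        fix x show "limit (stage d) x = lookup (map (\<lambda>x. the (limit (stage d) x)) [0..<Suc (k + k)]) x"
          using dom[of x] by (auto simp: lookup_def simp del: upt_Suc)
      qed
      then have "odd_list (limit (stage d))" unfolding odd_list_def
        by (intro exI[of _ "map (\<lambda>x. the (limit (stage d) x)) [0..<Suc (k + k)]"]) simp
      with assms show False ..
    qed
    then obtain r where r: "r \<ge> s" "\<not> odd_stage d r" by blast
    then have "stage d r x = Suc y" using growingD[OF growing_stage, of d s x r] s by simp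
    with r have "published d r x = Suc y" by (auto simp: published_def)
    then have "limit (published d) x = Some y" using limit_Some_iff[OF growing_published] by blast
    with Some show ?thesis by simp
  qed
qed

lemma limit_published_not_odd: "\<not> odd_list (limit (published d))"
proof
  assume "odd_list (limit (published d))"
  then obtain l where l: "odd (length l)" "limit (published d) = lookup l" unfolding odd_list_def by blast
  have "\<exists>r. \<not> odd_stage d r \<and> stage d r x \<noteq> 0" if "x < length l" for x
  proof -
    have "limit (published d) x \<noteq> None" using that l(2) by (simp add: lookup_def)
    then show ?thesis unfolding limit_None_iff by (metis published_nonzeroE)
  qed
  then obtain r where r: "\<And>x. x < length l \<Longrightarrow> \<not> odd_stage d (r x) \<and> stage d (r x) x \<noteq> 0" by metis
  define s where "s = Max (r ` {..<length l})"
  have "l \<noteq> []" using l(1) by auto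
  then have "s \<in> r ` {..<length l}" unfolding s_def by (intro Max_in) auto
  then have good: "\<not> odd_stage d s" using r by auto
  have "stage d s x \<noteq> 0 \<longleftrightarrow> x < length l" for x
  proof
    assume "stage d s x \<noteq> 0"
    with good have "published d s x \<noteq> 0" by (auto simp: published_def)
    then have "limit (published d) x \<noteq> None" by (auto simp: limit_None_iff)
    then show "x < length l" unfolding l(2) by (auto simp: lookup_def split: if_splits)
  next
    assume x: "x < length l"
    then have "r x \<le> s" unfolding s_def by (intro Max_ge) auto
    then show "stage d s x \<noteq> 0" using r[OF x] growingD[OF growing_stage] by metis
  qed
  moreover obtain k where "length l = Suc (k + k)" using l(1) by (metis oddE Suc_eq_plus1 mult_2)
  ultimately have "odd_stage d s" unfolding odd_stage_iff by auto
  with good show False ..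
qed

lemma dec_odd_stage': "decidable (\<lambda>z. odd_stage (pfst z) (psnd z))"
  unfolding odd_stage_def by (intro computable_intros)
lemmas dec_odd_stage [computable_intros] = dec_app2[OF dec_odd_stage']


lemma tc_published': "total_computable (\<lambda>z. published (pfst z) (pfst (psnd z)) (psnd (psnd z)))"
  unfolding published_def by (intro computable_intros)
lemmas tc_published [computable_intros] = tc_app3[OF tc_published']

subsection \<open>Minimal indices\<close>

text \<open>
  At stage \<open>t\<close> the function with index \<open>e\<close> differs below \<open>s\<close> from all those with smaller indices. The
  index \<open>e\<close> is minimal iff this holds for some \<open>s\<close> at all stages \<open>t \<ge> s\<close>; so a wrong guess of \<open>s\<close> is
  refuted at some stage.
\<close>

definition distinct_at :: "nat \<Rightarrow> nat \<Rightarrow> nat \<Rightarrow> bool" where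
  "distinct_at e s t \<longleftrightarrow> (\<forall>d<e. \<exists>x<s. published d t x \<noteq> published e t x)"

definition minimal :: "nat \<Rightarrow> bool" where
  "minimal e \<longleftrightarrow> (\<forall>d<e. limit (published d) \<noteq> limit (published e))"

lemma distinct_from_minimal:
  assumes "minimal e"
  shows "\<exists>s. \<forall>t\<ge>s. distinct_at e s t"
proof -
  have "\<exists>s. \<forall>t\<ge>s. \<exists>x<s. published d t x \<noteq> published e t x" if d: "d < e" for d
  proof -
    obtain x where x: "limit (published d) x \<noteq> limit (published e) x"
      using assms d unfolding minimal_def fun_eq_iff by blast
    obtain r where r: "\<forall>t\<ge>r. published d t x = option_code (limit (published d) x)"
      using limit_reached[OF growing_published[of d], of x] by blast
    obtain s where s: "\<forall>t\<ge>s. published e t x = option_code (limit (published e) x)"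
      using limit_reached[OF growing_published[of e], of x] by blast
    show ?thesis
    proof (rule exI[of _ "max (Suc x) (max r s)"], intro allI impI)
      fix t assume t: "max (Suc x) (max r s) \<le> t"
      then have "r \<le> t" "s \<le> t" by simp_all
      then have "published d t x = option_code (limit (published d) x)" "published e t x = option_code (limit (published e) x)"
        using r s by blast+
      then have "published d t x \<noteq> published e t x" using x by simp
      moreover have "x < max (Suc x) (max r s)" by simp
      ultimately show "\<exists>y<max (Suc x) (max r s). published d t y \<noteq> published e t y" by blast
    qed
  qed
  then obtain s where s: "\<And>d t. d < e \<Longrightarrow> t \<ge> s d \<Longrightarrow> \<exists>x<s d. published d t x \<noteq> published e t x" by metis
  define m where "m = Max (insert 0 (s ` {..<e}))"
  have "s d \<le> m" if "d < e" for d unfolding m_def using that by (intro Max_ge) auto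
  then have "\<forall>t\<ge>m. distinct_at e m t"
    unfolding distinct_at_def by (meson s order_trans order_less_le_trans)
  then show ?thesis ..
qed

lemma minimal_from_distinct:
  assumes "\<forall>t\<ge>s. distinct_at e s t"
  shows "minimal e"
  unfolding minimal_def
proof (intro allI impI notI)
  fix d assume d: "d < e" and eq: "limit (published d) = limit (published e)"
  obtain q where q: "\<forall>t\<ge>q. \<forall>x<s. published d t x = option_code (limit (published d) x)"
    using limit_reached_below[OF growing_published[of d], of s] by blast
  obtain r where r: "\<forall>t\<ge>r. \<forall>x<s. published e t x = option_code (limit (published e) x)"
    using limit_reached_below[OF growing_published[of e], of s] by blast
  have "distinct_at e s (max s (max q r))" using assms by simp
  then obtain x where "x < s" "published d (max s (max q r)) x \<noteq> published e (max s (max q r)) x"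
    using d unfolding distinct_at_def by blast
  then show False using q r eq by simp
qed

lemma distinct_at_mono: "distinct_at e s t \<Longrightarrow> s \<le> s' \<Longrightarrow> distinct_at e s' t"
  unfolding distinct_at_def by (meson order_less_le_trans)

lemma dec_distinct_at': "decidable (\<lambda>z. distinct_at (pfst z) (pfst (psnd z)) (psnd (psnd z)))"
  unfolding distinct_at_def by (intro computable_intros)
lemmas dec_distinct_at [computable_intros] = dec_app3[OF dec_distinct_at']

section \<open>Items\<close>

text \<open>
  The functions are named by items, which come in three kinds. A follower is meant for the function
  with index \<open>e\<close> under the guess that \<open>s\<close> is the least number that shows \<open>e\<close> to be minimal, where \<open>r\<close> is
  the first stage that refutes \<open>s - 1\<close> (and 0 if \<open>s = 0\<close>). A holder of \<open>a\<close> is meant for the marker of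
  \<open>a\<close>. A filler is the odd list with code \<open>g\<close>; its second component is the time of the event that drove
  the holder away from \<open>g\<close> if \<open>g\<close> is a marker, and 0 otherwise.
\<close>

\<comment> \<open>The tag 1 stays a numeral.\<close>
declare One_nat_def [simp del]

abbreviation follower :: "nat \<Rightarrow> nat \<Rightarrow> nat \<Rightarrow> nat" where
  "follower e s r \<equiv> pcode 0 (pcode e (pcode s r))"
abbreviation holder :: "nat \<Rightarrow> nat" where
  "holder a \<equiv> pcode 1 a"
abbreviation filler :: "nat \<Rightarrow> nat \<Rightarrow> nat" where
  "filler g t \<equiv> pcode 2 (pcode g t)"

abbreviation marker :: "nat \<Rightarrow> nat list" where
  "marker a \<equiv> [pcode 1 a]"

definition content :: "nat \<Rightarrow> nat \<Rightarrow> nat \<Rightarrow> nat" where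
  "content c t x =
     (if pfst c = 0 then published (pfst (psnd c)) t x
      else if pfst c = 1 then (if x = 0 then Suc c else 0)
      else list_entry (pfst (psnd c)) x)"

text \<open>
  Requiring \<open>r\<close> to refute \<open>s - 1\<close> ensures that among the guesses for \<open>e\<close> that are never refuted only
  the least one has a follower.
\<close>

definition starts :: "nat \<Rightarrow> nat \<Rightarrow> nat \<Rightarrow> bool" where
  "starts e s r \<longleftrightarrow>
     (s = 0 \<and> r = 0) \<or>
     (s \<noteq> 0 \<and> s - 1 \<le> r \<and> \<not> distinct_at e (s - 1) r \<and> (\<forall>u<r. s - 1 \<le> u \<longrightarrow> distinct_at e (s - 1) u))"

definition releasable :: "nat \<Rightarrow> bool" where
  "releasable c \<longleftrightarrow> pfst c = 1 \<or>
     (pfst c = 0 \<and> starts (pfst (psnd c)) (pfst (psnd (psnd c))) (psnd (psnd (psnd c))))"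

text \<open>
  An item \<open>c\<close> that is released at stage \<open>t\<close> turns into a list of odd length \<open>2t + 3\<close>. It extends the
  content at that stage, which lies below \<open>2t + 2\<close>; truncated subtraction fills the gaps with 0. The
  last entry identifies \<open>c\<close> and \<open>t\<close>; its tag 0 and the length distinguish the list from all markers.
\<close>

definition final_value :: "nat \<Rightarrow> nat \<Rightarrow> nat \<Rightarrow> nat" where
  "final_value c t x = (if x < Suc (Suc (t + t)) then Suc (content c t x - 1)
     else if x = Suc (Suc (t + t)) then Suc (pcode 0 (pcode c t)) else 0)"

definition final_list :: "nat \<Rightarrow> nat \<Rightarrow> nat list" where
  "final_list c t = map (\<lambda>x. content c t x - 1) [0..<Suc (Suc (t + t))] @ [pcode 0 (pcode c t)]"

lemma length_final_list [simp]: "length (final_list c t) = Suc (Suc (Suc (t + t)))"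
  by (simp add: final_list_def)

lemma final_value_eq: "final_value c t x = option_code (lookup (final_list c t) x)"
  by (simp add: final_value_def lookup_def final_list_def nth_append del: upt_Suc)

lemma final_list_inject:
  assumes "final_list c t = final_list d u"
  shows "c = d"
proof -
  have "last (final_list c t) = last (final_list d u)" using assms by simp
  then show ?thesis by (simp add: final_list_def)
qed

lemma list_entry_eq: "list_entry g x = option_code (lookup (list_decode g) x)"
  using list_entry_list_encode[of "list_decode g" x] by (simp add: lookup_def)

lemma limit_eqI:
  assumes "growing A" "\<And>x. \<exists>s. \<forall>t\<ge>s. A t x = option_code (f x)"
  shows "limit A = f"
proof
  fix x
  obtain s where s: "\<forall>t\<ge>s. A t x = option_code (f x)" using assms(2) by blast
  obtain r where r: "\<forall>t\<ge>r. A t x = option_code (limit A x)" using limit_reached[OF assms(1), of x] by blast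
  have "option_code (f x) = option_code (limit A x)" using s r by (metis max.cobounded1 max.cobounded2)
  then show "limit A x = f x" by simp
qed

lemma growing_content: "growing (content c)"
  using growing_published[of "pfst (psnd c)"] unfolding growing_def content_def by auto

lemma limit_content_follower: "limit (content (follower e s r)) = limit (published e)"
proof -
  have "content (follower e s r) = published e" by (intro ext) (simp add: content_def)
  then show ?thesis by simp
qed

lemma limit_content_holder: "limit (content (holder a)) = lookup (marker a)"
  by (rule limit_eqI[OF growing_content]) (auto simp: content_def lookup_def)

lemma limit_content_filler: "limit (content (filler g t)) = lookup (list_decode g)"
  by (rule limit_eqI[OF growing_content]) (auto simp: content_def list_entry_eq)

lemma content_bound:
  assumes "pfst c = 0 \<or> pfst c = 1" "content c t x \<noteq> 0"
  shows "x < Suc (Suc (t + t))"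
  using assms published_bound[of "pfst (psnd c)" t x] by (auto simp: content_def split: if_splits)

lemma starts_unique: "starts e s r \<Longrightarrow> starts e s r' \<Longrightarrow> r = r'"
  unfolding starts_def by (metis linorder_neqE_nat)

lemma starts_least:
  assumes "starts e s r" "\<forall>t\<ge>s'. distinct_at e s' t"
  shows "s \<le> s'"
proof (rule ccontr)
  assume "\<not> s \<le> s'"
  then have "s' \<le> s - 1" "s \<noteq> 0" by simp_all
  moreover from this assms(1) have "s - 1 \<le> r" "\<not> distinct_at e (s - 1) r"
    by (auto simp: starts_def)
  ultimately show False using assms(2) distinct_at_mono[of e s' r "s - 1"] by auto
qed

lemma starts_ex:
  assumes "minimal e"
  shows "\<exists>s r. starts e s r \<and> (\<forall>t\<ge>s. distinct_at e s t)"
proof -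
  define s where "s = (LEAST s. \<forall>t\<ge>s. distinct_at e s t)"
  have s: "\<forall>t\<ge>s. distinct_at e s t"
    unfolding s_def using distinct_from_minimal[OF assms] by (rule LeastI_ex)
  have "\<exists>r. starts e s r"
  proof (cases s)
    case 0
    then show ?thesis by (auto simp: starts_def)
  next
    case (Suc m)
    then have "\<not> (\<forall>t\<ge>m. distinct_at e m t)"
      using not_less_Least[of m "\<lambda>s. \<forall>t\<ge>s. distinct_at e s t"] by (auto simp: s_def)
    then have "\<exists>t. m \<le> t \<and> \<not> distinct_at e m t" by blast
    then obtain r where "m \<le> r \<and> \<not> distinct_at e m r" "\<forall>u<r. \<not> (m \<le> u \<and> \<not> distinct_at e m u)"
      using exists_least_iff[of "\<lambda>t. m \<le> t \<and> \<not> distinct_at e m t"] by blast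
    then have "starts e s r" by (simp add: starts_def Suc)
    then show ?thesis ..
  qed
  with s show ?thesis by blast
qed

lemma mem_le_list_encode: "x \<in> set l \<Longrightarrow> x \<le> list_encode l"
proof (induction l)
  case (Cons y l)
  then show ?case using le_pcode[where a = y and b = "list_encode l"] by auto
qed simp

lemma length_le_list_encode: "length l \<le> list_encode l"
proof (induction l)
  case (Cons y l)
  then show ?case using le_pcode(2)[where a = y and b = "list_encode l"] by simp
qed simp

lemma odd_length_iff:
  "odd (length (list_decode g)) \<longleftrightarrow> (\<exists>k\<le>g. list_entry g (k + k) \<noteq> 0 \<and> list_entry g (Suc (k + k)) = 0)"
proof
  assume "odd (length (list_decode g))"
  then obtain k where k: "length (list_decode g) = Suc (k + k)" by (metis oddE Suc_eq_plus1 mult_2)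
  then have "k \<le> g" using length_le_list_encode[of "list_decode g"] by simp
  then show "\<exists>k\<le>g. list_entry g (k + k) \<noteq> 0 \<and> list_entry g (Suc (k + k)) = 0"
    using k by (auto simp: list_entry_eq lookup_def)
next
  assume "\<exists>k\<le>g. list_entry g (k + k) \<noteq> 0 \<and> list_entry g (Suc (k + k)) = 0"
  then obtain k where "list_entry g (k + k) \<noteq> 0" "list_entry g (Suc (k + k)) = 0" by blast
  then have "length (list_decode g) = Suc (k + k)"
    by (auto simp: list_entry_eq lookup_def split: if_splits)
  then show "odd (length (list_decode g))" by simp
qed

lemma marker_code_iff: "list_decode g = marker a \<longleftrightarrow> g = Suc (pcode (pcode 1 a) 0)"
  by (metis list_decode_inverse list_encode_inverse list_encode.simps(1) list_encode_Cons)

lemma odd_list_lookup [simp]: "odd_list (lookup l) \<longleftrightarrow> odd (length l)"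
  by (auto simp: odd_list_def)

text \<open>
  The event \<open>event i a t\<close> makes the holder of \<open>a\<close> in the \<open>i\<close>-th numbering leave its marker at time \<open>t\<close>.
  The construction works for arbitrary decidable events that occur at most once.
\<close>

locale escape =
  fixes event :: "nat \<Rightarrow> nat \<Rightarrow> nat \<Rightarrow> bool"
  assumes dec_event': "decidable (\<lambda>z. event (pfst z) (pfst (psnd z)) (psnd (psnd z)))"
    and event_unique: "event i a t \<Longrightarrow> event i a u \<Longrightarrow> t = u"
begin

definition abandons :: "nat \<Rightarrow> nat \<Rightarrow> nat \<Rightarrow> bool" where
  "abandons i c t \<longleftrightarrow>
     (pfst c = 0 \<and> pfst (psnd (psnd c)) \<le> t \<and> \<not> distinct_at (pfst (psnd c)) (pfst (psnd (psnd c))) t) \<or>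
     (pfst c = 1 \<and> event i (psnd c) t)"

definition released :: "nat \<Rightarrow> nat \<Rightarrow> nat \<Rightarrow> bool" where
  "released i c t \<longleftrightarrow> abandons i c t \<and> (\<forall>u<t. \<not> abandons i c u)"

text \<open>
  The time of release if it is at most \<open>t\<close>; otherwise \<open>t\<close>, at which time the item is not abandoned.
\<close>

definition first_abandon :: "nat \<Rightarrow> nat \<Rightarrow> nat \<Rightarrow> nat" where
  "first_abandon i c t = (LEAST u. u = t \<or> abandons i c u)"

definition item_stage :: "nat \<Rightarrow> nat \<Rightarrow> nat \<Rightarrow> nat \<Rightarrow> nat" where
  "item_stage i c t x =
     (if abandons i c (first_abandon i c t) then final_value c (first_abandon i c t) x else content c t x)"

lemma released_ex: "abandons i c t \<Longrightarrow> \<exists>u. released i c u"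
  using exists_least_iff[of "abandons i c"] unfolding released_def by auto

lemma item_stage_released:
  assumes "released i c u"
  shows "item_stage i c t x = (if u \<le> t then final_value c u x else content c t x)"
proof (cases "u \<le> t")
  case True
  have "first_abandon i c t = u" unfolding first_abandon_def
  proof (rule Least_equality)
    show "u = t \<or> abandons i c u" using assms by (simp add: released_def)
    fix v assume "v = t \<or> abandons i c v"
    then show "u \<le> v" using assms True unfolding released_def by (metis not_less)
  qed
  then show ?thesis using assms True by (simp add: item_stage_def released_def)
next
  case False
  have "first_abandon i c t \<le> t" unfolding first_abandon_def by (rule Least_le) simp
  then have "\<not> abandons i c (first_abandon i c t)"
    using assms False unfolding released_def by (metis le_less_trans not_less)
  then show ?thesis using False by (simp add: item_stage_def)
qed

lemma item_stage_unreleased: "\<forall>u. \<not> released i c u \<Longrightarrow> item_stage i c t x = content c t x"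
  using released_ex[of i c] by (auto simp: item_stage_def)

lemma growing_item_stage: "growing (item_stage i c)"
proof (cases "\<exists>u. released i c u")
  case False
  then show ?thesis
    using growing_content[of c] by (simp add: growing_def item_stage_unreleased)
next
  case True
  then obtain u where u: "released i c u" ..
  then have c: "pfst c = 0 \<or> pfst c = 1" by (auto simp: released_def abandons_def)
  have agree: "final_value c u x = content c s x" if "content c s x \<noteq> 0" "s < u" for s x
  proof -
    have "content c u x = content c s x" 
      by (rule growingD[OF growing_content that(1)]) (use that(2) in simp)
    moreover have "x < Suc (Suc (u + u))" using content_bound[OF c, of u x] that(1) calculation by simp
    ultimately show ?thesis using that(1) by (simp add: final_value_def)
  qed
  show ?thesis unfolding growing_def
  proof (intro allI impI)
    fix s t x assume "s \<le> t" "item_stage i c s x \<noteq> 0"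
    then show "item_stage i c t x = item_stage i c s x"
      using agree[of s x] growingD[OF growing_content, of c s x t]
      by (auto simp: item_stage_released[OF u] split: if_splits)
  qed
qed

definition item_fun :: "nat \<Rightarrow> nat \<Rightarrow> nat \<Rightarrow> nat option" where
  "item_fun i c = limit (item_stage i c)"

lemma item_fun_released:
  assumes "released i c u"
  shows "item_fun i c = lookup (final_list c u)"
  unfolding item_fun_def
  by (rule limit_eqI[OF growing_item_stage]) (auto simp: item_stage_released[OF assms] final_value_eq)

lemma item_fun_unreleased: "\<forall>u. \<not> released i c u \<Longrightarrow> item_fun i c = limit (content c)"
proof -
  assume "\<forall>u. \<not> released i c u"
  then have "item_stage i c = content c" by (intro ext) (rule item_stage_unreleased)
  then show ?thesis by (simp add: item_fun_def)
qed

text \<open>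
  Both the item and the time of its release are bounded by \<open>g\<close>, because the last entry of the final
  list codes them; this makes the predicate decidable.
\<close>

definition taken :: "nat \<Rightarrow> nat \<Rightarrow> bool" where
  "taken i g \<longleftrightarrow> (\<exists>c\<le>g. \<exists>t\<le>g. releasable c \<and> released i c t \<and>
     (\<forall>x\<le>Suc (Suc (Suc (t + t))). list_entry g x = final_value c t x))"

lemma taken_iff: "taken i g \<longleftrightarrow> (\<exists>c t. releasable c \<and> released i c t \<and> list_decode g = final_list c t)"
proof
  assume "taken i g"
  then obtain c t where ct: "releasable c" "released i c t"
    and eq: "\<forall>x\<le>Suc (Suc (Suc (t + t))). lookup (list_decode g) x = lookup (final_list c t) x"
    unfolding taken_def by (auto simp: list_entry_eq final_value_eq)
  have "lookup (list_decode g) (Suc (Suc (Suc (t + t)))) = lookup (final_list c t) (Suc (Suc (Suc (t + t))))"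
    using eq by blast
  then have len: "length (list_decode g) \<le> Suc (Suc (Suc (t + t)))"
    by (auto simp: lookup_def split: if_splits)
  have "lookup (list_decode g) x = lookup (final_list c t) x" for x
  proof (cases "x \<le> Suc (Suc (Suc (t + t)))")
    case True
    then show ?thesis using eq by blast
  next
    case False
    then show ?thesis using len by (simp add: lookup_def)
  qed
  then have "list_decode g = final_list c t" using lookup_inject by blast
  with ct show "\<exists>c t. releasable c \<and> released i c t \<and> list_decode g = final_list c t" by blast
next
  assume "\<exists>c t. releasable c \<and> released i c t \<and> list_decode g = final_list c t"
  then obtain c t where ct: "releasable c" "released i c t" and eq: "list_decode g = final_list c t" by blast
  have "pcode 0 (pcode c t) \<in> set (list_decode g)" unfolding eq by (simp add: final_list_def)
  then have "pcode 0 (pcode c t) \<le> g" using mem_le_list_encode by fastforce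
  then have "c \<le> g" "t \<le> g"
    using le_pcode(2)[where a = 0 and b = "pcode c t"] le_pcode[where a = c and b = t] by simp_all
  then show "taken i g" unfolding taken_def using ct eq by (auto simp: list_entry_eq final_value_eq)
qed

text \<open>
  The items that are in use in the \<open>i\<close>-th numbering. A filler is in use for its odd list iff no other
  item ends up with that list: for a marker, iff the holder has left it, and for any other list, iff
  it is not taken.
\<close>

definition occupied :: "nat \<Rightarrow> nat \<Rightarrow> bool" where
  "occupied i c \<longleftrightarrow> releasable c \<or>
     (pfst c = 2 \<and> (\<exists>k\<le>pfst (psnd c). list_entry (pfst (psnd c)) (k + k) \<noteq> 0 \<and> list_entry (pfst (psnd c)) (Suc (k + k)) = 0)
      \<and> ((\<exists>a\<le>pfst (psnd c). pfst (psnd c) = Suc (pcode (pcode 1 a) 0) \<and> event i a (psnd (psnd c)))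
         \<or> (psnd (psnd c) = 0 \<and> \<not> taken i (pfst (psnd c))
            \<and> \<not> (\<exists>a\<le>pfst (psnd c). pfst (psnd c) = Suc (pcode (pcode 1 a) 0)))))"

lemma occupied_filler_iff:
  "occupied i (filler g t) \<longleftrightarrow> odd (length (list_decode g)) \<and>
     ((\<exists>a. list_decode g = marker a \<and> event i a t) \<or>
      (t = 0 \<and> \<not> taken i g \<and> (\<forall>a. list_decode g \<noteq> marker a)))"
proof -
  have "a \<le> Suc (pcode (pcode 1 a) 0)" for a
    using le_pcode(1)[where a = "pcode 1 a" and b = 0] le_pcode(2)[where a = 1 and b = a] by linarith
  then show ?thesis
    unfolding occupied_def by (auto simp: releasable_def odd_length_iff marker_code_iff)
qed

lemma item_fun_filler: "item_fun i (filler g t) = lookup (list_decode g)"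
proof -
  have "\<forall>u. \<not> released i (filler g t) u" by (simp add: released_def abandons_def)
  then show ?thesis by (simp add: item_fun_unreleased limit_content_filler)
qed

lemma item_fun_holder:
  assumes "\<forall>t. \<not> event i a t"
  shows "item_fun i (holder a) = lookup (marker a)"
proof -
  have "\<forall>u. \<not> released i (holder a) u" using assms by (simp add: released_def abandons_def)
  then show ?thesis by (simp add: item_fun_unreleased limit_content_holder)
qed

text \<open>
  Every item in use ends in exactly one of five ways. Which one is determined by its function alone,
  as the four lemmas \<open>owner_of\<close> below show; this is the core of injectivity.
\<close>

lemma occupied_cases:
  assumes "occupied i c"
  obtains
    (released) t where "releasable c" "released i c t" "item_fun i c = lookup (final_list c t)"
  | (follower) e s r where "c = follower e s r" "starts e s r" "\<forall>t\<ge>s. distinct_at e s t"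
      "item_fun i c = limit (published e)"
  | (holder) a where "c = holder a" "\<forall>t. \<not> event i a t" "item_fun i c = lookup (marker a)"
  | (moved) a t where "c = filler (list_encode (marker a)) t" "event i a t"
      "item_fun i c = lookup (marker a)"
  | (filler) l where "c = filler (list_encode l) 0" "odd (length l)" "\<not> taken i (list_encode l)"
      "\<forall>a. l \<noteq> marker a" "item_fun i c = lookup l"
proof -
  have "releasable c \<or> pfst c = 2" using assms by (auto simp: occupied_def)
  then consider (rel) t where "releasable c" "released i c t"
    | (hold) "pfst c = 1" "\<forall>u. \<not> released i c u"
    | (foll) "releasable c" "pfst c = 0" "\<forall>u. \<not> released i c u"
    | (fill) "pfst c = 2"
    unfolding releasable_def by blast
  then show thesis
  proof cases
    case rel
    then show thesis using that(1) item_fun_released by blast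
  next
    case hold
    define a where "a = psnd c"
    with hold have c: "c = holder a" using pcode_proj[of c] by simp
    have "\<forall>t. \<not> event i a t" using released_ex[of i c] hold by (auto simp: abandons_def a_def)
    moreover have "item_fun i c = lookup (marker a)"
      unfolding c using calculation by (rule item_fun_holder)
    ultimately show thesis using that(3) c by blast
  next
    case foll
    define e s r where "e = pfst (psnd c)" "s = pfst (psnd (psnd c))" "r = psnd (psnd (psnd c))"
    then have c: "c = follower e s r" using foll pcode_proj[of c] by simp
    have "starts e s r" using foll(1,2) c by (simp add: releasable_def)
    moreover have "\<forall>t\<ge>s. distinct_at e s t"
      using released_ex[of i c] foll c by (auto simp: abandons_def)
    moreover have "item_fun i c = limit (published e)"
      using item_fun_unreleased[OF foll(3)] by (simp add: c limit_content_follower)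
    ultimately show thesis using that(2) c by blast
  next
    case fill
    define g t where "g = pfst (psnd c)" "t = psnd (psnd c)"
    then have c: "c = filler g t" using fill pcode_proj[of c] by simp
    show thesis
    proof (cases "\<exists>a. list_decode g = marker a")
      case True
      then obtain a where a: "list_decode g = marker a" by blast
      then have "event i a t" using assms unfolding c occupied_filler_iff by auto
      moreover have "g = list_encode (marker a)" using a by (metis list_decode_inverse)
      ultimately show thesis using that(4) c item_fun_filler[of i g t] a by simp
    next
      case False
      then have "t = 0" "\<not> taken i g" "odd (length (list_decode g))"
        using assms unfolding c occupied_filler_iff by auto
      then show thesis using that(5)[of "list_decode g"] c item_fun_filler[of i g t] False by simp
    qed
  qed
qed

lemma owner_of_non_list:
  assumes "occupied i c" "\<not> odd_list (item_fun i c)"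
  obtains e s r where "c = follower e s r" "starts e s r" "\<forall>t\<ge>s. distinct_at e s t"
    "item_fun i c = limit (published e)"
  using assms(1) by (cases rule: occupied_cases) (use assms(2) in auto)

lemma owner_of_final_list:
  assumes "occupied i d" "releasable c" "released i c t" "item_fun i d = lookup (final_list c t)"
  shows "d = c"
  using assms(1)
proof (cases rule: occupied_cases)
  case (released u)
  then have "final_list d u = final_list c t" using assms(4) by simp
  then show ?thesis by (rule final_list_inject)
next
  case (follower e s r)
  then have "\<not> odd_list (item_fun i d)" using limit_published_not_odd by simp
  then show ?thesis using assms(4) by simp
next
  case (holder a)
  then have "length (final_list c t) = length (marker a)" using assms(4) by simp
  then show ?thesis by simp
next
  case (moved a u)
  then have "length (final_list c t) = length (marker a)" using assms(4) by simp
  then show ?thesis by simp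
next
  case (filler l)
  then have "list_decode (list_encode l) = final_list c t" using assms(4) by simp
  then have "taken i (list_encode l)" unfolding taken_iff using assms(2,3) by blast
  with filler show ?thesis by simp
qed

lemma owner_of_marker:
  assumes "occupied i d" "item_fun i d = lookup (marker a)"
  shows "d = holder a \<and> (\<forall>t. \<not> event i a t) \<or>
         (\<exists>t. d = filler (list_encode (marker a)) t \<and> event i a t)"
  using assms(1)
proof (cases rule: occupied_cases)
  case (released u)
  then have "length (final_list d u) = length (marker a)" using assms(2) by simp
  then show ?thesis by simp
next
  case (follower e s r)
  then have "\<not> odd_list (item_fun i d)" using limit_published_not_odd by simp
  then show ?thesis using assms(2) by simp
qed (use assms(2) in auto)

lemma owner_of_list:
  assumes "occupied i d" "item_fun i d = lookup l" "odd (length l)" "\<not> taken i (list_encode l)"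
    "\<forall>a. l \<noteq> marker a"
  shows "d = filler (list_encode l) 0"
  using assms(1)
proof (cases rule: occupied_cases)
  case (released u)
  then have "taken i (list_encode l)" unfolding taken_iff using assms(2) by auto
  with assms(4) show ?thesis by simp
next
  case (follower e s r)
  then have "\<not> odd_list (item_fun i d)" using limit_published_not_odd by simp
  then show ?thesis using assms(2,3) by simp
qed (use assms(2,5) in auto)

lemma minimal_unique: "minimal d \<Longrightarrow> minimal e \<Longrightarrow> limit (published d) = limit (published e) \<Longrightarrow> d = e"
  unfolding minimal_def by (metis linorder_neqE_nat)

lemma item_fun_inject:
  assumes c: "occupied i c" and d: "occupied i d" and eq: "item_fun i c = item_fun i d"
  shows "c = d"
  using c
proof (cases rule: occupied_cases)
  case (released t)
  then show ?thesis using owner_of_final_list[OF d, of c t] eq by simp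
next
  case (follower e s r)
  then have "\<not> odd_list (item_fun i d)" using limit_published_not_odd eq by metis
  from owner_of_non_list[OF d this] obtain e' s' r' where
    d': "d = follower e' s' r'" "starts e' s' r'" "\<forall>t\<ge>s'. distinct_at e' s' t"
      "item_fun i d = limit (published e')" .
  have "e' = e"
    using minimal_unique minimal_from_distinct follower(3,4) d'(3,4) eq by metis
  moreover from this have "s' = s"
    using starts_least follower(2,3) d'(2,3) by (meson le_antisym)
  moreover from calculation have "r' = r" using starts_unique follower(2) d'(2) by blast
  ultimately show ?thesis using follower(1) d'(1) by simp
next
  case (holder a)
  then have "item_fun i d = lookup (marker a)" using eq by simp
  from owner_of_marker[OF d this] holder(1,2) show ?thesis by blast
next
  case (moved a t)
  then have "item_fun i d = lookup (marker a)" using eq by simp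
  from owner_of_marker[OF d this] moved(2) obtain u where
    "d = filler (list_encode (marker a)) u" "event i a u" by blast
  moreover from this(2) moved(2) have "u = t" by (rule event_unique)
  ultimately show ?thesis using moved(1) by simp
next
  case (filler l)
  then show ?thesis using owner_of_list[OF d, of l] eq by simp
qed

lemma item_fun_surj:
  assumes "partial_computable1 f"
  shows "\<exists>c. occupied i c \<and> item_fun i c = f"
proof (cases "odd_list f")
  case True
  then obtain l where l: "odd (length l)" "f = lookup l" unfolding odd_list_def by blast
  let ?g = "list_encode l"
  consider (taken) "taken i ?g" | (moved) a t where "l = marker a" "event i a t"
    | (holder) a where "l = marker a" "\<forall>t. \<not> event i a t"
    | (filler) "\<not> taken i ?g" "\<forall>a. l \<noteq> marker a" by blast
  then show ?thesis
  proof cases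
    case taken
    then obtain c t where "releasable c" "released i c t" "l = final_list c t"
      unfolding taken_iff by auto
    then show ?thesis using item_fun_released l(2) by (auto simp: occupied_def)
  next
    case (moved a t)
    then have occ: "occupied i (filler ?g t)" using l(1) by (simp add: occupied_filler_iff)
    moreover have "item_fun i (filler ?g t) = f"
      using l(2) by (simp add: item_fun_filler)
    ultimately show ?thesis by blast
  next
    case (holder a)
    then have "item_fun i (holder a) = f" using item_fun_holder l(2) by simp
    moreover have "occupied i (holder a)" by (simp add: occupied_def releasable_def)
    ultimately show ?thesis by blast
  next
    case filler
    then have occ: "occupied i (filler ?g 0)" using l(1) by (simp add: occupied_filler_iff)
    moreover have "item_fun i (filler ?g 0) = f"
      using l(2) by (simp add: item_fun_filler)
    ultimately show ?thesis by blast
  qed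
next
  case False
  obtain p where p: "\<And>x. eval p [x] = f x" using assms unfolding partial_computable1_def by blast
  have "limit (stage (code p)) = f" by (intro ext) (simp add: limit_stage_code p)
  with limit_published False have "limit (published (code p)) = f" by metis
  then have ex: "\<exists>e. limit (published e) = f" ..
  define e where "e = (LEAST e. limit (published e) = f)"
  have e: "limit (published e) = f" unfolding e_def using ex by (rule LeastI_ex)
  have "limit (published d) \<noteq> f" if "d < e" for d
    using that unfolding e_def by (rule not_less_Least)
  with e have "minimal e" by (simp add: minimal_def)
  then obtain s r where sr: "starts e s r" "\<forall>t\<ge>s. distinct_at e s t" using starts_ex by blast
  have "occupied i (follower e s r)" using sr by (simp add: occupied_def releasable_def)
  moreover have "\<forall>u. \<not> released i (follower e s r) u" using sr by (auto simp: released_def abandons_def)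
  then have "item_fun i (follower e s r) = f"
    by (simp add: item_fun_unreleased limit_content_follower e)
  ultimately show ?thesis by blast
qed

lemma item_fun_holder_event:
  assumes "event i a t"
  shows "item_fun i (holder a) \<noteq> lookup (marker a)"
proof -
  have "abandons i (holder a) t" using assms by (simp add: abandons_def)
  then obtain u where "released i (holder a) u" using released_ex by blast
  then have *: "item_fun i (holder a) = lookup (final_list (holder a) u)" by (rule item_fun_released)
  have "length (final_list (holder a) u) \<noteq> length (marker a)" by simp
  then show ?thesis unfolding * lookup_inject by metis
qed

end


section \<open>Computability of the items\<close>

lemma limit_program:
  assumes "total_computable (\<lambda>z. A (pfst z) (pfst (psnd z)) (psnd (psnd z)))"
  shows "\<exists>p. \<forall>y x. eval p [y, x] = limit (A y) x"
proof -
  obtain r where r: "\<And>z. eval r [z] = Some (A (pfst z) (pfst (psnd z)) (psnd (psnd z)) - 1)"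
    using total_computableE[OF tc_diff[OF assms tc_const[of 1]]] by blast
  have "decidable (\<lambda>z. A (pfst z) (pfst (psnd z)) (psnd (psnd z)) = 0)"
    by (intro dec_eq assms tc_const)
  then obtain q where q: "\<And>z. eval q [z] = Some (of_bool (A (pfst z) (pfst (psnd z)) (psnd (psnd z)) = 0))"
    unfolding decidable_def using total_computableE by blast
  obtain pp where pp: "\<And>x y. eval pp [x, y] = Some (pcode x y)"
    using total_computable2E[OF tc2_pcode] by blast
  define code3 where "code3 = Comp pp [Proj 1, Comp pp [Proj 0, Proj 2]]"
  have code3: "eval code3 [t, y, x] = Some (pcode y (pcode t x))" for t y x
    by (simp add: code3_def pp)
  have "eval (Mu (Comp q [code3])) [y, x] =
      (if \<exists>t. A y t x \<noteq> 0 then Some (LEAST t. A y t x \<noteq> 0) else None)" for y x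
    by (rule eval_Mu_total) (simp add: q code3)
  then have "eval (Comp (Comp r [code3]) [Mu (Comp q [code3]), Proj 0, Proj 1]) [y, x] = limit (A y) x" for y x
    by (simp add: r code3 limit_def del: eval.simps(6))
  then show ?thesis by blast
qed

lemma half_eq: "n div 2 = (LEAST m. n \<le> Suc (m + m))" for n :: nat
  by (rule Least_equality[symmetric]) auto

lemma tc_half [computable_intros]:
  "total_computable f \<Longrightarrow> total_computable (\<lambda>x. f x div 2)"
proof -
  have "total_computable (\<lambda>n. LEAST m. n \<le> Suc (m + m))"
    by (intro tc_Least computable_intros) presburger
  then show "total_computable f \<Longrightarrow> total_computable (\<lambda>x. f x div 2)"
    unfolding half_eq by (rule tc_comp)
qed

lemma tc_content': "total_computable (\<lambda>z. content (pfst z) (pfst (psnd z)) (psnd (psnd z)))"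
  unfolding content_def by (intro computable_intros)
lemmas tc_content [computable_intros] = tc_app3[OF tc_content']

lemma tc_final_value': "total_computable (\<lambda>z. final_value (pfst z) (pfst (psnd z)) (psnd (psnd z)))"
  unfolding final_value_def by (intro computable_intros)
lemmas tc_final_value [computable_intros] = tc_app3[OF tc_final_value']

lemma dec_starts': "decidable (\<lambda>z. starts (pfst z) (pfst (psnd z)) (psnd (psnd z)))"
  unfolding starts_def by (intro computable_intros)
lemmas dec_starts [computable_intros] = dec_app3[OF dec_starts']

lemma dec_releasable [computable_intros]: "total_computable f \<Longrightarrow> decidable (\<lambda>x. releasable (f x))"
  unfolding releasable_def by (intro computable_intros)

lemma tc_enumerate:
  assumes dec: "decidable (\<lambda>z. psnd z \<in> S (pfst z))" and inf: "\<And>i. infinite (S i)"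
  shows "total_computable (\<lambda>z. enumerate (S (pfst z)) (psnd z))"
proof -
  have mem: "decidable (\<lambda>x. g x \<in> S (f x))" if "total_computable f" "total_computable g" for f g
    using decidable_comp[OF dec tc_pcode[OF that]] by simp
  have rec: "enumerate (S i) n = rec_nat (LEAST c. c \<in> S i) (\<lambda>_ r. LEAST c. c \<in> S i \<and> r < c) n" for i n
    by (induction n) (simp_all add: enumerate_0 enumerate_Suc''[OF inf] del: enumerate_Suc)
  have 1: "\<exists>n. n \<in> S i" for i using inf[of i] by (metis finite.emptyI ex_in_conv)
  have 2: "\<exists>n. n \<in> S i \<and> r < n" for i r using inf[of i] by (meson infinite_nat_iff_unbounded)
  have "total_computable (\<lambda>z. LEAST c. c \<in> S (pfst z))"
    by (intro tc_Least mem computable_intros 1)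
  moreover have "total_computable (\<lambda>z. LEAST c. c \<in> S (pfst (pfst z)) \<and> psnd (psnd z) < c)"
    by (intro tc_Least mem computable_intros 2)
  ultimately show ?thesis unfolding rec by (intro tc_rec tc_psnd tc_id)
qed

context escape
begin

lemmas dec_event [computable_intros] = dec_app3[OF dec_event']

lemma dec_abandons': "decidable (\<lambda>z. abandons (pfst z) (pfst (psnd z)) (psnd (psnd z)))"
  unfolding abandons_def by (intro computable_intros)
lemmas dec_abandons [computable_intros] = dec_app3[OF dec_abandons']

lemma dec_released': "decidable (\<lambda>z. released (pfst z) (pfst (psnd z)) (psnd (psnd z)))"
  unfolding released_def by (intro computable_intros)
lemmas dec_released [computable_intros] = dec_app3[OF dec_released']

lemma tc_first_abandon': "total_computable (\<lambda>z. first_abandon (pfst z) (pfst (psnd z)) (psnd (psnd z)))"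
  unfolding first_abandon_def by (intro tc_Least computable_intros) blast
lemmas tc_first_abandon [computable_intros] = tc_app3[OF tc_first_abandon']

lemma tc_item_stage': "total_computable (\<lambda>z. item_stage (pfst z) (pfst (psnd z)) (pfst (psnd (psnd z))) (psnd (psnd (psnd z))))"
  unfolding item_stage_def by (intro computable_intros)
lemmas tc_item_stage [computable_intros] = tc_app4[OF tc_item_stage']

lemma dec_taken': "decidable (\<lambda>z. taken (pfst z) (psnd z))"
  unfolding taken_def by (intro computable_intros)
lemmas dec_taken [computable_intros] = dec_app2[OF dec_taken']

lemma dec_occupied': "decidable (\<lambda>z. occupied (pfst z) (psnd z))"
  unfolding occupied_def by (intro computable_intros)
lemmas dec_occupied [computable_intros] = dec_app2[OF dec_occupied']

subsection \<open>The numberings\<close>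

text \<open>
  Even indices are reserved for the holders, so that the index of a holder does not depend on the
  numbering or on the events. The remaining items in use form an infinite decidable set and are listed
  in increasing order along the odd indices.
\<close>

definition movable :: "nat \<Rightarrow> nat set" where
  "movable i = {c. occupied i c \<and> pfst c \<noteq> 1}"

lemma infinite_movable: "infinite (movable i)"
proof -
  define c where "c k = filler (list_encode [pcode 3 k]) 0" for k
  have "c k \<in> movable i" for k
  proof -
    have "\<not> taken i (list_encode [pcode 3 k])"
    proof
      assume "taken i (list_encode [pcode 3 k])"
      then obtain d t where "list_decode (list_encode [pcode 3 k]) = final_list d t"
        unfolding taken_iff by blast
      from arg_cong[OF this, of length] show False by simp
    qed
    then show ?thesis unfolding c_def movable_def by (simp add: occupied_filler_iff)
  qed
  moreover have "inj c" unfolding c_def by (intro injI) simp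
  ultimately show ?thesis by (meson finite_subset image_subsetI range_inj_infinite)
qed

definition item :: "nat \<Rightarrow> nat \<Rightarrow> nat" where
  "item i n = (if n = n div 2 + n div 2 then holder (n div 2) else enumerate (movable i) (n div 2))"

lemma item_double: "item i (a + a) = holder a"
  by (simp add: item_def flip: mult_2)

lemma occupied_item: "occupied i (item i n)"
proof (cases "n = n div 2 + n div 2")
  case True
  then show ?thesis by (simp add: item_def occupied_def releasable_def)
next
  case False
  have "enumerate (movable i) (n div 2) \<in> movable i" by (rule enumerate_in_set[OF infinite_movable])
  with False show ?thesis by (simp add: item_def movable_def)
qed

lemma inj_item: "inj (item i)"
proof (rule injI)
  fix m n assume eq: "item i m = item i n"
  have mov: "pfst (enumerate (movable i) k) \<noteq> 1" for k
    using enumerate_in_set[OF infinite_movable, of i k] by (simp add: movable_def)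
  have "pfst (item i k) = 1 \<longleftrightarrow> k = k div 2 + k div 2" for k
    using mov by (simp add: item_def)
  with eq have par: "m = m div 2 + m div 2 \<longleftrightarrow> n = n div 2 + n div 2" by metis
  have "m div 2 = n div 2"
  proof (cases "m = m div 2 + m div 2")
    case True
    then show ?thesis using eq par unfolding item_def by simp
  next
    case False
    then have "enumerate (movable i) (m div 2) = enumerate (movable i) (n div 2)"
      using eq par unfolding item_def by simp
    then show ?thesis using inj_enumerate[OF infinite_movable] by (metis injD)
  qed
  with par show "m = n" by presburger
qed

lemma item_surj:
  assumes "occupied i c"
  shows "\<exists>n. item i n = c"
proof (cases "pfst c = 1")
  case True
  then have "item i (psnd c + psnd c) = c" using pcode_proj[of c] by (simp add: item_double)
  then show ?thesis ..
next
  case False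
  then have "c \<in> movable i" using assms by (simp add: movable_def)
  then obtain m where "enumerate (movable i) m = c" using enumerate_Ex[OF infinite_movable] by blast
  then have "item i (Suc (m + m)) = c" by (simp add: item_def flip: mult_2)
  then show ?thesis ..
qed

lemma tc_item [computable_intros]:
  assumes "total_computable f" "total_computable g"
  shows "total_computable (\<lambda>x. item (f x) (g x))"
proof -
  have "decidable (\<lambda>z. psnd z \<in> movable (pfst z))"
    unfolding movable_def mem_Collect_eq by (intro computable_intros)
  note tc_app2[OF tc_enumerate[OF this infinite_movable], computable_intros]
  show ?thesis unfolding item_def by (intro computable_intros assms)
qed

definition friedberg :: "nat \<Rightarrow> nat \<Rightarrow> nat \<Rightarrow> nat option" where
  "friedberg i n = item_fun i (item i n)"

lemma inj_friedberg: "inj (friedberg i)"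
proof (rule injI)
  fix m n assume "friedberg i m = friedberg i n"
  then have "item i m = item i n"
    unfolding friedberg_def by (rule item_fun_inject[OF occupied_item occupied_item])
  then show "m = n" by (rule injD[OF inj_item])
qed

lemma uniformly_ce_friedberg: "uniformly_ce friedberg"
proof -
  have "total_computable (\<lambda>z. item_stage (pfst (pfst z)) (item (pfst (pfst z)) (psnd (pfst z)))
      (pfst (psnd z)) (psnd (psnd z)))"
    by (intro computable_intros)
  then have "\<exists>p. \<forall>y x. eval p [y, x] = limit (item_stage (pfst y) (item (pfst y) (psnd y))) x"
    by (rule limit_program)
  then obtain p where p: "\<And>y x. eval p [y, x] = limit (item_stage (pfst y) (item (pfst y) (psnd y))) x"
    by blast
  obtain pp where pp: "\<And>x y. eval pp [x, y] = Some (pcode x y)"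
    using total_computable2E[OF tc2_pcode] by blast
  have "eval (Comp p [Comp pp [Proj 0, Proj 1], Proj 2]) [i, n, x] = friedberg i n x" for i n x
    by (simp add: p pp friedberg_def item_fun_def)
  then show ?thesis unfolding uniformly_ce_def partial_computable3_def by blast
qed

end

lemma partial_computable_fix_args:
  assumes "partial_computable3 F"
  shows "partial_computable2 (F i)" "partial_computable1 (F i n)"
proof -
  obtain p where p: "\<And>x y z. eval p [x, y, z] = F x y z"
    using assms unfolding partial_computable3_def by blast
  obtain c where c: "\<And>xs. eval c xs = Some i" using constant_program[of i] by blast
  obtain d where d: "\<And>xs. eval d xs = Some n" using constant_program[of n] by blast
  have "eval (Comp p [c, Proj 0, Proj 1]) [y, z] = F i y z" for y z by (simp add: p c)
  then show "partial_computable2 (F i)" unfolding partial_computable2_def by blast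
  have "eval (Comp p [c, d, Proj 0]) [z] = F i n z" for z by (simp add: p c d)
  then show "partial_computable1 (F i n)" unfolding partial_computable1_def by blast
qed

context escape
begin

lemma friedberg_numbering_friedberg: "friedberg_numbering P1 (friedberg i)"
proof -
  have pc: "partial_computable3 friedberg" using uniformly_ce_friedberg by (simp add: uniformly_ce_def)
  have "f \<in> range (friedberg i)" if f: "f \<in> P1" for f
  proof -
    have "partial_computable1 f" using f by (simp add: P1_def)
    from item_fun_surj[OF this] obtain c where c: "occupied i c" "item_fun i c = f" by blast
    from item_surj[OF c(1)] obtain n where "item i n = c" ..
    with c have "friedberg i n = f" by (simp add: friedberg_def)
    then show ?thesis by blast
  qed
  moreover have "range (friedberg i) \<subseteq> P1"
    using partial_computable_fix_args(2)[OF pc] by (auto simp: P1_def)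
  ultimately have "numbering P1 (friedberg i)" unfolding numbering_def by blast
  then show ?thesis unfolding friedberg_numbering_def computable_numbering_def
    using partial_computable_fix_args(1)[OF pc] inj_friedberg by simp
qed

lemma friedberg_double:
  "friedberg i (a + a) = lookup (marker a) \<longleftrightarrow> (\<forall>t. \<not> event i a t)"
  unfolding friedberg_def item_double using item_fun_holder item_fun_holder_event by blast

end

section \<open>Independence\<close>

theorem theorem9:
  fixes pair :: "nat \<times> nat \<Rightarrow> nat"
  assumes "computable_pairing pair"
  shows "\<exists>\<nu> :: nat \<Rightarrow> nat \<Rightarrow> nat \<Rightarrow> nat option.
           (\<forall>i. friedberg_numbering P1 (\<nu> i)) \<and>
           uniformly_ce \<nu> \<and>
           independent_numberings pair \<nu>"
proof -
  have bij: "bij pair" and "total_computable2 (\<lambda>x y. pair (x, y))"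
    using assms by (auto simp: computable_pairing_def total_computable2_def)
  note tc_pair = tc_comp2[OF this(2)]
  \<comment> \<open>Omitting position \<open>j\<close> moves index \<open>i > j\<close> to position \<open>i - 1\<close> of the direct sum.\<close>
  define event where "event i a t \<longleftrightarrow> i \<noteq> pfst a \<and> halts_at (psnd a) (a + a) t \<and>
    outcome t = pair (if i < pfst a then i else i - 1, a + a)" for i a t
  have "decidable (\<lambda>z. event (pfst z) (pfst (psnd z)) (psnd (psnd z)))"
    unfolding event_def by (intro computable_intros tc_pair)
  then interpret escape event
    by unfold_locales (auto simp: event_def intro: halts_at_unique)
  have "\<not> reducible (friedberg j) (direct_sum pair (omit j friedberg))" for j
  proof
    assume "reducible (friedberg j) (direct_sum pair (omit j friedberg))"
    then obtain f where f: "total_computable f" "friedberg j = direct_sum pair (omit j friedberg) \<circ> f"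
      unfolding reducible_def by blast
    obtain p where p: "\<And>x. eval p [x] = Some (f x)" using total_computableE[OF f(1)] by blast
    define a n where "a = pcode j (code p)" and "n = a + a"
    obtain t where t: "halts_at (code p) n t" "outcome t = f n" using p halts_at_code by blast
    obtain i' k where ik: "f n = pair (i', k)" using bij by (metis bij_pointE surj_pair)
    define i where "i = (if i' < j then i' else Suc i')"
    have i: "i \<noteq> j" "(if i < j then i else i - 1) = i'" "omit j friedberg i' = friedberg i"
      by (auto simp: i_def omit_def)
    have "friedberg j n = direct_sum pair (omit j friedberg) (f n)" using f(2) by simp
    also have "\<dots> = friedberg i k" by (simp add: ik direct_sum_pair[OF bij] i(3))
    finally have eq: "friedberg j n = friedberg i k" .
    have "friedberg j n = lookup (marker a)"
      unfolding n_def friedberg_double by (simp add: event_def a_def)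
    with eq have k: "friedberg i k = lookup (marker a)" by simp
    \<comment> \<open>The event that threatens the marker in the numbering named by \<open>f n\<close> occurs iff \<open>f\<close> names index \<open>n\<close>.\<close>
    have event: "event i a u \<longleftrightarrow> u = t \<and> k = n" for u
    proof
      assume *: "event i a u"
      then have "halts_at (code p) n u" "outcome u = pair (i', n)"
        using i(2) by (simp_all add: event_def a_def n_def)
      then show "u = t \<and> k = n"
        using halts_at_unique[OF t(1)] t(2) ik bij_is_inj[OF bij] by (metis injD prod.inject)
    next
      assume "u = t \<and> k = n"
      then show "event i a u" using t ik i by (simp add: event_def a_def n_def)
    qed
    show False
    proof (cases "k = n")
      case True
      then have "event i a t" using event by simp
      then show False using k True friedberg_double[of i a] unfolding n_def by blast
    next
      case False
      then have "\<forall>u. \<not> event i a u" using event by simp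
      then have "friedberg i n = lookup (marker a)" unfolding n_def friedberg_double .
      with k have "friedberg i n = friedberg i k" by simp
      then show False using False inj_friedberg by (metis injD)
    qed
  qed
  then have "independent_numberings pair friedberg" by (simp add: independent_numberings_def)
  with friedberg_numbering_friedberg uniformly_ce_friedberg show ?thesis by blast
qed

end
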